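(* Let $G\le\mathrm{O}(d)$ be finite, $m:=|G|$, $\chi:=\chi(G)$. Let $\lambda_0$ and $n\in\mathbb{N}$ satisfy $\lambda:=\frac{n}{\chi d}\ge\lambda_0>1$, and let $z_1,\ldots,z_n\in\mathbb{R}^d$ have independent standard Gaussian entries. Then there exist an absolute constant $C>0$ and $c=c(\lambda_0)>0$ such that the max filter bank $\Phi:\mathbb{R}^d/G\to\mathbb{R}^n$, $\Phi([x])=(\langle\!\langle[z_i],[x]\rangle\!\rangle)_{i=1}^n$, has distortion $$\kappa(\Phi)\le\Big(C\chi^{3/2}m\log^{1/2}(em)\Big)^{1+c\lambda^{-1/2}}$$ with probability at least $1-3e^{-d\sqrt{\lambda}}$. In fact one may take $C=4e^{3/2}$ and $c(\lambda_0)=2+\frac{\sqrt{\lambda_0}+2}{\lambda_0-1}$.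
   Context: For $x\in\mathbb{R}^d$, $[x]:=\{gx:g\in G\}$; $d([x],[y]):=\min_{p\in[x],q\in[y]}\|p-q\|$; $\langle\!\langle[x],[y]\rangle\!\rangle:=\max_{p\in[x],q\in[y]}\langle p,q\rangle$. The open Voronoi cell $V_x$ is the set of $y$ such that $x$ is the unique maximizer of $\langle p,y\rangle$ over $p\in[x]$. $P(G):=\{x:\mathrm{stab}_G(x)=\{\mathrm{id}\}\}$, $S(x,y):=\{q\in[y]:V_q\cap V_x\ne\varnothing\}$, and $\chi(G):=\max_{x,y\in P(G)}|S(x,y)|$. For a map $f:\mathbb{R}^d/G\to\mathbb{R}^n$, let $\alpha,\beta\in[0,\infty]$ be the largest and smallest constants with $\alpha\,d([x],[y])\le\|f([x])-f([y])\|\le\beta\,d([x],[y])$ for all $x,y$; the distortion is $\kappa(f):=\beta/\alpha$, with $\kappa(f)=\infty$ if $\alpha=0$ or $\beta=\infty$. *)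

theory Defs
  imports "HOL-Analysis.Analysis" "HOL-Probability.Probability"
begin

definition finite_orth_group :: "(real^'d^'d) set \<Rightarrow> bool" where
  "finite_orth_group G \<longleftrightarrow> finite G \<and> mat 1 \<in> G \<and>
     (\<forall>g\<in>G. orthogonal_matrix g) \<and>
     (\<forall>g\<in>G. \<forall>h\<in>G. g ** h \<in> G) \<and> (\<forall>g\<in>G. transpose g \<in> G)"

definition orbit :: "(real^'d^'d) set \<Rightarrow> real^'d \<Rightarrow> (real^'d) set" where
  "orbit G x = (\<lambda>g. g *v x) ` G"

definition orbit_dist :: "(real^'d^'d) set \<Rightarrow> real^'d \<Rightarrow> real^'d \<Rightarrow> real" where
  "orbit_dist G x y = Min {norm (p - q) | p q. p \<in> orbit G x \<and> q \<in> orbit G y}"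

definition max_filter :: "(real^'d^'d) set \<Rightarrow> real^'d \<Rightarrow> real^'d \<Rightarrow> real" where
  "max_filter G x y = Max {p \<bullet> q | p q. p \<in> orbit G x \<and> q \<in> orbit G y}"

definition voronoi :: "(real^'d^'d) set \<Rightarrow> real^'d \<Rightarrow> (real^'d) set" where
  "voronoi G x = {y. \<forall>p\<in>orbit G x. p \<noteq> x \<longrightarrow> p \<bullet> y < x \<bullet> y}"

definition stab :: "(real^'d^'d) set \<Rightarrow> real^'d \<Rightarrow> (real^'d^'d) set" where
  "stab G x = {g\<in>G. g *v x = x}"

definition principal :: "(real^'d^'d) set \<Rightarrow> (real^'d) set" where
  "principal G = {x. stab G x = {mat 1}}"

definition S_set :: "(real^'d^'d) set \<Rightarrow> real^'d \<Rightarrow> real^'d \<Rightarrow> (real^'d) set" where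
  "S_set G x y = {q\<in>orbit G y. voronoi G q \<inter> voronoi G x \<noteq> {}}"

definition chi :: "(real^'d^'d) set \<Rightarrow> nat" where
  "chi G = Max {card (S_set G x y) | x y. x \<in> principal G \<and> y \<in> principal G}"

definition dist_n :: "nat \<Rightarrow> (nat \<Rightarrow> real) \<Rightarrow> (nat \<Rightarrow> real) \<Rightarrow> real" where
  "dist_n n u v = sqrt (\<Sum>i<n. (u i - v i)^2)"

text \<open>Bi-Lipschitz constants and distortion of a map R^d/G -> R^n,
  given by a function on representatives.\<close>
definition lower_lip :: "(real^'d^'d) set \<Rightarrow> nat \<Rightarrow> (real^'d \<Rightarrow> nat \<Rightarrow> real) \<Rightarrow> ereal" where
  "lower_lip G n f = Sup {a::ereal. 0 \<le> a \<and>
     (\<forall>x y. a * ereal (orbit_dist G x y) \<le> ereal (dist_n n (f x) (f y)))}"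

definition upper_lip :: "(real^'d^'d) set \<Rightarrow> nat \<Rightarrow> (real^'d \<Rightarrow> nat \<Rightarrow> real) \<Rightarrow> ereal" where
  "upper_lip G n f = Inf {b::ereal. 0 \<le> b \<and>
     (\<forall>x y. ereal (dist_n n (f x) (f y)) \<le> b * ereal (orbit_dist G x y))}"

definition distortion :: "(real^'d^'d) set \<Rightarrow> nat \<Rightarrow> (real^'d \<Rightarrow> nat \<Rightarrow> real) \<Rightarrow> ereal" where
  "distortion G n f = (if lower_lip G n f = 0 \<or> upper_lip G n f = \<infinity> then \<infinity>
      else upper_lip G n f / lower_lip G n f)"

definition max_filter_bank :: "(real^'d^'d) set \<Rightarrow> nat \<Rightarrow> (nat \<Rightarrow> real^'d) \<Rightarrow> real^'d \<Rightarrow> nat \<Rightarrow> real" where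
  "max_filter_bank G n z x = (\<lambda>i. if i < n then max_filter G (z i) x else 0)"

definition gauss_space :: "nat \<Rightarrow> ((nat \<times> 'd::finite) \<Rightarrow> real) measure" where
  "gauss_space n = PiM ({..<n} \<times> UNIV) (\<lambda>_. density lborel std_normal_density)"

definition gauss_vecs :: "((nat \<times> 'd::finite) \<Rightarrow> real) \<Rightarrow> nat \<Rightarrow> real^'d" where
  "gauss_vecs \<omega> i = (\<chi> j. \<omega> (i, j))"

end

theory Submission
  imports Defs
begin

text \<open>
  For \<open>h \<in> G\<^sup>n\<close> let \<open>A\<^sub>h\<close> be the matrix with rows \<open>h\<^sub>i z\<^sub>i\<close>. The upper Lipschitz constant of the filter
  bank is at most the largest operator norm of the \<open>A\<^sub>h\<close>. For the lower one, the differences of the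
  max filters at principal points \<open>x, y\<close> are \<open>\<langle>h\<^sub>i z\<^sub>i, x - q\<^sub>i\<rangle>\<close> with \<open>q\<^sub>i \<in> S(x,y)\<close>; by pigeonhole at least
  \<open>n / \<chi> = \<lambda>d\<close> of the \<open>q\<^sub>i\<close> coincide, so the lower constant is at least the smallest singular value of
  a submatrix of some \<open>A\<^sub>h\<close> with \<open>k = \<lceil>\<lambda>d\<rceil>\<close> rows. Nonprincipal points follow by density.

  Both quantities are controlled by a net of the unit sphere and a Chernoff bound at each point \<open>x\<close>
  of the net. The union over \<open>h\<close> is cheap because
  \<open>exp (a |A\<^sub>h x|\<^sup>2) \<le> \<Prod>\<^sub>i \<Sum>\<^sub>g exp (a \<langle>g z\<^sub>i, x\<rangle>\<^sup>2)\<close> for all \<open>h\<close> at once, and the right-hand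
  side has expectation \<open>(m / sqrt (1 - 2a))\<^sup>k\<close> for \<open>k\<close> rows. With \<open>a = 3/8\<close> and a \<open>1/6\<close>-net the
  norms are at most \<open>b = 2 sqrt (n ln (e m)) exp (2 / sqrt \<lambda>)\<close>; with \<open>a < 0\<close> and a \<open>1/R\<close>-net, where \<open>R\<close> is
  the claimed distortion, the singular values are at least \<open>b / R\<close>.
\<close>

section \<open>Nets of the sphere\<close>

text \<open>Volume comparison: the balls of radius \<open>e/2\<close> about the points are disjoint
  and lie in the ball of radius \<open>1 + e/2\<close>.\<close>

lemma card_separated_sphere_le:
  fixes S :: "'a::euclidean_space set"
  assumes fin: "finite S" and S: "S \<subseteq> sphere 0 1" and e: "0 < e"
    and sep: "\<And>x y. x \<in> S \<Longrightarrow> y \<in> S \<Longrightarrow> x \<noteq> y \<Longrightarrow> e \<le> dist x y"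
  shows "real (card S) \<le> (1 + 2 / e) ^ DIM('a)"
proof -
  let ?v = "unit_ball_vol (real DIM('a))"
  have disj: "disjoint_family_on (\<lambda>x. ball x (e/2)) S"
    unfolding disjoint_family_on_def
  proof (intro ballI impI)
    fix x y assume xy: "x \<in> S" "y \<in> S" "x \<noteq> y"
    show "ball x (e/2) \<inter> ball y (e/2) = {}"
    proof (rule ccontr)
      assume "ball x (e/2) \<inter> ball y (e/2) \<noteq> {}"
      then obtain w where "dist x w < e/2" "dist y w < e/2" by auto
      then have "dist x y < e" using dist_triangle2[of x y w] by linarith
      with sep[OF xy] show False by simp
    qed
  qed
  have "real (card S) * (?v * (e/2) ^ DIM('a)) = (\<Sum>x\<in>S. measure lborel (ball x (e/2)))"
    using e by (simp add: content_ball)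
  also have "\<dots> = measure lborel (\<Union>x\<in>S. ball x (e/2))"
    by (rule measure_finite_Union[symmetric, OF fin _ disj]) (use emeasure_lborel_ball_finite in \<open>auto simp: less_top\<close>)
  also have "\<dots> \<le> measure lborel (ball (0::'a) (1 + e/2))"
  proof (rule measure_mono_fmeasurable)
    show "(\<Union>x\<in>S. ball x (e/2)) \<subseteq> ball 0 (1 + e/2)"
    proof (rule UN_least)
      fix x assume "x \<in> S"
      with S have "dist 0 x = 1" by auto
      then have "dist 0 w < 1 + e/2" if "dist x w < e/2" for w
        using dist_triangle[of 0 w x] that by linarith
      then show "ball x (e/2) \<subseteq> ball 0 (1 + e/2)" by (auto simp: subset_iff)
    qed
  qed (use emeasure_lborel_ball_finite[of "0::'a" "1 + e/2"] in
      \<open>auto simp: fmeasurable_def intro!: borel_open\<close>)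
  also have "\<dots> = ?v * (1 + e/2) ^ DIM('a)"
    using e by (simp add: content_ball)
  finally have "?v * (real (card S) * (e/2) ^ DIM('a)) \<le> ?v * (1 + e/2) ^ DIM('a)"
    by (simp add: mult_ac)
  then have "real (card S) * (e/2) ^ DIM('a) \<le> (1 + e/2) ^ DIM('a)"
    by (subst (asm) mult_le_cancel_left_pos) auto
  then have "real (card S) \<le> (1 + e/2) ^ DIM('a) / (e/2) ^ DIM('a)"
    using e by (simp add: pos_le_divide_eq)
  also have "\<dots> = ((1 + e/2) / (e/2)) ^ DIM('a)"
    by (rule power_divide[symmetric])
  also have "(1 + e/2) / (e/2) = 1 + 2 / e"
    using e by (simp add: field_simps)
  finally show ?thesis .
qed

text \<open>A separated set of maximal cardinality is a net, since a point farther than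
  \<open>e\<close> from all of it could be added. The volume bound shows that a maximum exists and
  also limits the size of the net.\<close>

lemma sphere_net_exists:
  fixes e :: real
  assumes e: "0 < e"
  shows "\<exists>N :: 'a::euclidean_space set. finite N \<and> N \<subseteq> sphere 0 1 \<and>
    real (card N) \<le> (1 + 2 / e) ^ DIM('a) \<and> (\<forall>x. norm x = 1 \<longrightarrow> (\<exists>y\<in>N. norm (x - y) \<le> e))"
proof -
  define P where "P S \<longleftrightarrow> finite S \<and> S \<subseteq> sphere (0::'a) 1 \<and>
    (\<forall>x\<in>S. \<forall>y\<in>S. x \<noteq> y \<longrightarrow> e \<le> dist x y)" for S
  have bound: "real (card S) \<le> (1 + 2 / e) ^ DIM('a)" if "P S" for S
    using that card_separated_sphere_le[of S e] e unfolding P_def by blast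
  have "card S \<le> nat \<lfloor>(1 + 2 / e) ^ DIM('a)\<rfloor>" if "P S" for S
    using bound[OF that] by (simp add: le_nat_floor)
  moreover have "P {}" by (simp add: P_def)
  ultimately obtain S where S: "P S" "\<And>T. P T \<Longrightarrow> card T \<le> card S"
    using ex_has_greatest_nat[of P "{}" card "Suc (nat \<lfloor>(1 + 2 / e) ^ DIM('a)\<rfloor>)"]
    by (auto simp: less_Suc_eq_le)
  have "\<exists>y\<in>S. norm (x - y) \<le> e" if x: "norm x = 1" for x
  proof (rule ccontr)
    assume "\<not> (\<exists>y\<in>S. norm (x - y) \<le> e)"
    then have far: "\<And>y. y \<in> S \<Longrightarrow> e < dist x y" by (auto simp: dist_norm)
    have "x \<notin> S" using far[of x] e by auto
    have "P (insert x S)"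
      using S(1) x far unfolding P_def
      by (auto simp: less_imp_le dist_commute)
    from S(2)[OF this] show False
      using \<open>x \<notin> S\<close> S(1) by (simp add: P_def)
  qed
  with S(1) bound[OF S(1)] show ?thesis unfolding P_def by blast
qed

text \<open>Bootstrapping at a maximizer \<open>x0\<close> on the sphere: a nearby net point gives
  \<open>\<nu> x0 \<le> a + e * \<nu> x0\<close>, which is solved for \<open>\<nu> x0\<close>.
  Continuity supplies the maximizer.\<close>

lemma seminorm_le_of_net:
  fixes \<nu> :: "'a::euclidean_space \<Rightarrow> real"
  assumes tri: "\<And>x y. \<nu> (x + y) \<le> \<nu> x + \<nu> y"
    and hom: "\<And>c x. \<nu> (c *\<^sub>R x) = \<bar>c\<bar> * \<nu> x"
    and cont: "continuous_on UNIV \<nu>"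
    and net: "\<And>x. norm x = 1 \<Longrightarrow> \<exists>y\<in>N. norm (x - y) \<le> e"
    and e: "e < 1"
    and le: "\<And>y. y \<in> N \<Longrightarrow> \<nu> y \<le> a"
  shows "\<nu> x \<le> a / (1 - e) * norm x"
proof -
  have "sphere (0::'a) 1 \<noteq> {}" by simp
  then obtain x0 where x0: "norm x0 = 1" and sup: "\<And>x. norm x = 1 \<Longrightarrow> \<nu> x \<le> \<nu> x0"
    using continuous_attains_sup[of "sphere (0::'a) 1" \<nu>] continuous_on_subset[OF cont]
    by auto
  have "\<nu> 0 = 0" using hom[of 0 0] by simp
  have scale: "\<nu> x \<le> \<nu> x0 * norm x" for x
  proof (cases "x = 0")
    case True with \<open>\<nu> 0 = 0\<close> show ?thesis by simp
  next
    case False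
    have "\<nu> x = norm x * \<nu> (x /\<^sub>R norm x)"
      using hom[of "norm x" "x /\<^sub>R norm x"] False by simp
    also have "\<dots> \<le> norm x * \<nu> x0"
      using sup[of "x /\<^sub>R norm x"] False by (intro mult_left_mono) auto
    finally show ?thesis by (simp add: mult.commute)
  qed
  have nonneg: "0 \<le> \<nu> x0"
    using tri[of x0 "- x0"] hom[of "-1" x0] \<open>\<nu> 0 = 0\<close> by simp
  obtain y where y: "y \<in> N" "norm (x0 - y) \<le> e" using net[OF x0] by blast
  have "\<nu> x0 \<le> \<nu> y + \<nu> (x0 - y)" using tri[of y "x0 - y"] by simp
  also have "\<dots> \<le> a + \<nu> x0 * e"
    using le[OF y(1)] scale[of "x0 - y"] mult_left_mono[OF y(2) nonneg] by linarith
  finally have "\<nu> x0 \<le> a / (1 - e)"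
    using e by (simp add: field_simps)
  with scale[of x] show ?thesis
    by (meson dual_order.trans mult_right_mono norm_ge_zero)
qed

text \<open>Moving from a unit vector to a net point changes \<open>\<nu>\<close> by at most
  \<open>e * b\<close>, so the values on the net must carry this margin above
  \<open>t\<close>.\<close>

lemma seminorm_ge_of_net:
  fixes \<nu> :: "'a::euclidean_space \<Rightarrow> real"
  assumes tri: "\<And>x y. \<nu> (x + y) \<le> \<nu> x + \<nu> y"
    and hom: "\<And>c x. \<nu> (c *\<^sub>R x) = \<bar>c\<bar> * \<nu> x"
    and net: "\<And>x. norm x = 1 \<Longrightarrow> \<exists>y\<in>N. norm (x - y) \<le> e"
    and b: "0 \<le> b" "\<And>x. \<nu> x \<le> b * norm x"
    and ge: "\<And>y. y \<in> N \<Longrightarrow> t + e * b \<le> \<nu> y"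
  shows "t * norm x \<le> \<nu> x"
proof (cases "x = 0")
  case True then show ?thesis using hom[of 0 0] by simp
next
  case False
  define u where "u = x /\<^sub>R norm x"
  have "norm u = 1" using False by (simp add: u_def)
  then obtain y where y: "y \<in> N" "norm (u - y) \<le> e" using net by blast
  have "t + e * b \<le> \<nu> u + \<nu> (y - u)"
    using ge[OF y(1)] tri[of u "y - u"] by simp
  also have "\<nu> (y - u) \<le> b * e"
    using b(2)[of "y - u"] mult_left_mono[OF y(2) b(1)] by (simp add: norm_minus_commute)
  finally have "t \<le> \<nu> u" by (simp add: mult.commute)
  moreover have "\<nu> x = norm x * \<nu> u"
    using hom[of "norm x" u] False by (simp add: u_def)
  ultimately show ?thesis by (simp add: mult.commute[of t] mult_left_mono)
qed

section \<open>Gaussian vectors\<close>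

text \<open>The integrand is a multiple of a centered Gaussian density with variance
  \<open>1 / (1 - 2 * a)\<close>; \<open>s\<close> is its standard deviation. Negative
  \<open>a\<close> is included for the lower tail.\<close>

lemma nn_integral_std_normal_exp_square:
  fixes a :: real
  assumes "a < 1/2"
  shows "(\<integral>\<^sup>+x. ennreal (std_normal_density x) * ennreal (exp (a * x\<^sup>2)) \<partial>lborel)
    = ennreal (1 / sqrt (1 - 2 * a))"
proof -
  define s where "s = 1 / sqrt (1 - 2 * a)"
  have s: "s > 0" using assms by (simp add: s_def)
  have s2: "1 / s\<^sup>2 = 1 - 2 * a" using assms by (simp add: s_def power_divide)
  have eq: "std_normal_density x * exp (a * x\<^sup>2) = s * normal_density 0 s x" for x
  proof -
    have "- x\<^sup>2 / (2 * s\<^sup>2) = - (x\<^sup>2 / 2) * (1 / s\<^sup>2)" by simp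
    also have "\<dots> = - x\<^sup>2 / 2 + a * x\<^sup>2" unfolding s2 by (simp add: field_simps)
    finally have "- x\<^sup>2 / (2 * s\<^sup>2) = - x\<^sup>2 / 2 + a * x\<^sup>2" .
    moreover have "sqrt (2 * pi * s\<^sup>2) = sqrt (2 * pi) * s"
      using s by (simp add: real_sqrt_mult)
    ultimately show ?thesis
      using s by (simp add: normal_density_def exp_add[symmetric])
  qed
  have "(\<integral>\<^sup>+x. ennreal (std_normal_density x) * ennreal (exp (a * x\<^sup>2)) \<partial>lborel)
    = (\<integral>\<^sup>+x. ennreal s * ennreal (normal_density 0 s x) \<partial>lborel)"
    using s by (intro nn_integral_cong) (simp add: ennreal_mult[symmetric] eq normal_density_nonneg)
  also have "\<dots> = ennreal s * (\<integral>\<^sup>+x. ennreal (normal_density 0 s x) \<partial>lborel)"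
    by (rule nn_integral_cmult) simp
  also have "(\<integral>\<^sup>+x. ennreal (normal_density 0 s x) \<partial>lborel) = 1"
    using s by (simp add: nn_integral_eq_integral normal_density_nonneg)
  finally show ?thesis by (simp add: s_def)
qed

lemma prob_space_gauss_space: "prob_space (gauss_space n)"
  unfolding gauss_space_def by (intro prob_space_PiM prob_space_normal_density) simp

lemma sets_gauss_space:
  "sets (gauss_space n) = sets (PiM ({..<n} \<times> UNIV) (\<lambda>_. borel))"
  unfolding gauss_space_def by (intro sets_PiM_cong) auto

lemma gauss_coord_measurable [measurable]:
  assumes "i < n"
  shows "(\<lambda>\<omega>. \<omega> (i, j)) \<in> borel_measurable (gauss_space n)"
proof -
  have "(\<lambda>\<omega>. \<omega> (i, j)) \<in> borel_measurable (PiM ({..<n} \<times> UNIV) (\<lambda>_. borel))"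
    using assms by (intro measurable_component_singleton) auto
  then show ?thesis
    by (simp add: measurable_cong_sets[OF sets_gauss_space refl])
qed

lemma gauss_coord_indep:
  "prob_space.indep_vars (gauss_space n) (\<lambda>_. borel)
     (\<lambda>p \<omega>. \<omega> p) ({..<n} \<times> (UNIV :: 'd::finite set))"
proof (cases "n = 0")
  \<comment> \<open>The description of independence by product laws, used in the other case,
    requires a nonempty index set.\<close>
  case True
  interpret prob_space "gauss_space n :: ((nat \<times> 'd) \<Rightarrow> real) measure" by (rule prob_space_gauss_space)
  show ?thesis unfolding indep_vars_def indep_sets_def using True by simp
next
  case False
  let ?I = "{..<n} \<times> (UNIV :: 'd set)"
  let ?N = "\<lambda>_::nat \<times> 'd. density lborel std_normal_density"
  interpret prob_space "gauss_space n :: ((nat \<times> 'd) \<Rightarrow> real) measure" by (rule prob_space_gauss_space)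
  have N: "prob_space (?N p)" for p by (rule prob_space_normal_density) simp
  \<comment> \<open>Restriction to the full index set is the identity on this space, so the joint
    law is the product measure itself.\<close>
  have "distr (gauss_space n) (\<Pi>\<^sub>M i\<in>?I. borel) (\<lambda>x. \<lambda>i\<in>?I. x i)
      = distr (gauss_space n) (gauss_space n) (\<lambda>x. x)"
  proof (rule distr_cong)
    show "sets (\<Pi>\<^sub>M i\<in>?I. borel) = sets (gauss_space n)" by (rule sets_gauss_space[symmetric])
    fix x :: "nat \<times> 'd \<Rightarrow> real" assume "x \<in> space (gauss_space n)"
    then show "(\<lambda>i\<in>?I. x i) = x"
      by (auto simp: gauss_space_def space_PiM PiE_def extensional_def fun_eq_iff)
  qed simp
  also have "\<dots> = (\<Pi>\<^sub>M i\<in>?I. distr (gauss_space n) borel (\<lambda>\<omega>. \<omega> i))"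
    unfolding distr_id gauss_space_def
  proof (rule PiM_cong[OF refl])
    fix p assume p: "p \<in> ?I"
    have "distr (PiM ?I ?N) borel (\<lambda>\<omega>. \<omega> p) = distr (PiM ?I ?N) (?N p) (\<lambda>\<omega>. \<omega> p)"
      by (rule distr_cong) auto
    also have "\<dots> = ?N p" using distr_PiM_component[of ?I ?N p] N p by auto
    finally show "?N p = distr (PiM ?I ?N) borel (\<lambda>\<omega>. \<omega> p)" by simp
  qed
  finally show ?thesis
    using False by (subst indep_vars_iff_distr_eq_PiM') auto
qed

lemma gauss_coord_distributed:
  assumes "i < n"
  shows "distributed (gauss_space n) lborel (\<lambda>\<omega>. \<omega> (i, j :: 'd::finite)) std_normal_density"
proof -
  let ?I = "{..<n} \<times> (UNIV :: 'd set)"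
  let ?N = "\<lambda>_::nat \<times> 'd. density lborel std_normal_density"
  have N: "prob_space (?N p)" for p by (rule prob_space_normal_density) simp
  have "distr (gauss_space n) lborel (\<lambda>\<omega>. \<omega> (i, j)) = distr (PiM ?I ?N) (?N (i,j)) (\<lambda>\<omega>. \<omega> (i, j))"
    unfolding gauss_space_def by (rule distr_cong) auto
  also have "\<dots> = ?N (i, j)" using distr_PiM_component[of ?I ?N "(i,j)"] N assms by auto
  finally show ?thesis
    using gauss_coord_measurable[OF assms, of j] by (auto simp: distributed_def)
qed

lemma gauss_vecs_inner: "gauss_vecs \<omega> i \<bullet> v = (\<Sum>j\<in>UNIV. v $ j * \<omega> (i, j))"
  by (simp add: gauss_vecs_def inner_vec_def mult.commute)

lemma gauss_inner_measurable [measurable]: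
  assumes "i < n"
  shows "(\<lambda>\<omega>. gauss_vecs \<omega> i \<bullet> v) \<in> borel_measurable (gauss_space n)"
  unfolding gauss_vecs_inner using gauss_coord_measurable[OF assms] by measurable

text \<open>A combination of independent standard normals is normal, its variance is the sum of the
  squared weights, and this sum is 1 for a unit vector.\<close>

lemma gauss_inner_distributed:
  fixes v :: "real^'d"
  assumes i: "i < n" and v: "norm v = 1"
  shows "distributed (gauss_space n) lborel (\<lambda>\<omega>. gauss_vecs \<omega> i \<bullet> v) std_normal_density"
proof -
  interpret prob_space "gauss_space n :: ((nat \<times> 'd) \<Rightarrow> real) measure" by (rule prob_space_gauss_space)
  \<comment> \<open>Zero weights are dropped because the sum rule for independent normals needs
    positive standard deviations.\<close>
  define J where "J = {j. v $ j \<noteq> 0}"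
  have "J \<noteq> {}"
  proof
    assume "J = {}"
    then have "v = 0" by (auto simp: J_def vec_eq_iff)
    with v show False by simp
  qed
  have ind0: "indep_vars (\<lambda>_. borel) (\<lambda>j \<omega>. \<omega> (i, j)) (UNIV :: 'd set)"
  proof -
    have "indep_vars (\<lambda>j. PiM {(i, j)} (\<lambda>_. borel)) (\<lambda>j \<omega>. restrict (\<lambda>p. \<omega> p) {(i, j)}) (UNIV :: 'd set)"
      using i by (intro indep_vars_restrict[OF gauss_coord_indep]) (auto simp: disjoint_family_on_def)
    from indep_vars_compose2[OF this, of "\<lambda>j f. f (i, j)" "\<lambda>_. borel"]
    show ?thesis by simp
  qed
  have ind: "indep_vars (\<lambda>_. borel) (\<lambda>j \<omega>. v $ j * \<omega> (i, j)) J"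
    by (rule indep_vars_subset[OF indep_vars_compose2[OF ind0]]) auto
  have "distributed (gauss_space n) lborel (\<lambda>\<omega>. v $ j * \<omega> (i, j)) (normal_density 0 \<bar>v $ j\<bar>)"
    if "j \<in> J" for j
    using normal_density_affine[OF gauss_coord_distributed[OF i, of j], of "v $ j" 0] that
    by (simp add: J_def)
  then have "distributed (gauss_space n) lborel (\<lambda>\<omega>. \<Sum>j\<in>J. v $ j * \<omega> (i, j))
    (normal_density (\<Sum>j\<in>J. 0) (sqrt (\<Sum>j\<in>J. \<bar>v $ j\<bar>\<^sup>2)))"
    by (intro sum_indep_normal ind) (use \<open>J \<noteq> {}\<close> in \<open>auto simp: J_def\<close>)
  moreover have "(\<Sum>j\<in>J. \<bar>v $ j\<bar>\<^sup>2) = (\<Sum>j\<in>UNIV. (v $ j)\<^sup>2)"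
    by (simp, rule sum.mono_neutral_left) (auto simp: J_def)
  moreover have "(\<Sum>j\<in>UNIV. (v $ j)\<^sup>2) = 1"
    using v unfolding norm_vec_def L2_set_def by simp
  moreover have "(\<Sum>j\<in>J. v $ j * \<omega> (i, j)) = gauss_vecs \<omega> i \<bullet> v" for \<omega>
    unfolding gauss_vecs_inner by (rule sum.mono_neutral_left) (auto simp: J_def)
  ultimately show ?thesis by simp
qed

lemma gauss_exp_square:
  fixes v :: "real^'d"
  assumes "i < n" and "norm v = 1" and "a < 1/2"
  shows "(\<integral>\<^sup>+\<omega>. ennreal (exp (a * (gauss_vecs \<omega> i \<bullet> v)\<^sup>2)) \<partial>gauss_space n)
    = ennreal (1 / sqrt (1 - 2 * a))"
  using distributed_nn_integral[OF gauss_inner_distributed[OF assms(1,2)],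
      of "\<lambda>x. ennreal (exp (a * x\<^sup>2))"]
    nn_integral_std_normal_exp_square[OF assms(3)]
  by simp

text \<open>Distinct vectors read disjoint blocks \<open>{i} \<times> UNIV\<close> of the
  independent coordinates.\<close>

lemma gauss_vecs_indep:
  assumes [measurable]: "\<And>i. i < n \<Longrightarrow> F i \<in> borel_measurable borel"
  shows "prob_space.indep_vars (gauss_space n :: ((nat \<times> 'd::finite) \<Rightarrow> real) measure) (\<lambda>_. borel)
     (\<lambda>i \<omega>. (F i (gauss_vecs \<omega> i :: real^'d) :: ennreal)) {..<n}"
proof -
  interpret prob_space "gauss_space n :: ((nat \<times> 'd) \<Rightarrow> real) measure" by (rule prob_space_gauss_space)
  let ?K = "\<lambda>i::nat. {i} \<times> (UNIV :: 'd set)"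
  have "indep_vars (\<lambda>i. PiM (?K i) (\<lambda>_. borel)) (\<lambda>i \<omega>. restrict (\<lambda>p. \<omega> p) (?K i)) {..<n}"
    by (intro indep_vars_restrict[OF gauss_coord_indep]) (auto simp: disjoint_family_on_def)
  then have "indep_vars (\<lambda>_. borel) (\<lambda>i \<omega>. F i (gauss_vecs (restrict (\<lambda>p. \<omega> p) (?K i)) i)) {..<n}"
  proof (rule indep_vars_compose2)
    fix i assume "i \<in> {..<n}"
    then have F: "F i \<in> borel_measurable borel" using assms by auto
    have "(\<lambda>f. gauss_vecs f i) \<in> borel_measurable (PiM (?K i) (\<lambda>_. borel))"
      unfolding borel_measurable_euclidean_space[of "\<lambda>f. gauss_vecs f i"] gauss_vecs_inner
      by (intro ballI borel_measurable_sum borel_measurable_times borel_measurable_const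
          measurable_component_singleton) auto
    then show "(\<lambda>f. F i (gauss_vecs f i)) \<in> borel_measurable (PiM (?K i) (\<lambda>_. borel))"
      using F by measurable
  qed
  then show ?thesis by (simp add: gauss_vecs_def)
qed


text \<open>The product of these sums over the rows expands into a sum over all tuples of group
  elements. A single expectation thus handles every choice of translates.\<close>

definition orbit_exp_sum :: "(real^'d^'d) set \<Rightarrow> real \<Rightarrow> real^'d \<Rightarrow> real^'d \<Rightarrow> real" where
  "orbit_exp_sum G a x z = (\<Sum>g\<in>G. exp (a * ((g *v z) \<bullet> x)\<^sup>2))"

lemma inner_matrix_transpose: "(g *v z) \<bullet> x = z \<bullet> (transpose g *v x)"
  for g :: "real^'d^'d"
  by (metis dot_lmul_matrix inner_commute transpose_matrix_vector)

lemma norm_orthogonal_matrix_mult: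
  fixes g :: "real^'d^'d"
  assumes "orthogonal_matrix g"
  shows "norm (g *v x) = norm x"
  using assms unfolding orthogonal_matrix_def norm_eq_sqrt_inner
  by (simp add: inner_matrix_transpose matrix_vector_mul_assoc)

text \<open>Markov's inequality is applied to the product, whose expectation factors by
  independence. Each term is a Gaussian moment at the unit vector \<open>transpose g *v x\<close>.
  The sign of \<open>a\<close> is free, so the lemma serves both tails.\<close>

lemma gauss_orbit_tail:
  fixes G :: "(real^'d^'d) set" and v :: real
  assumes G: "finite_orth_group G" and I: "I \<subseteq> {..<n}" and x: "norm x = 1" and a: "a < 1/2"
  defines "T \<equiv> {\<omega> \<in> space (gauss_space n). exp v \<le> (\<Prod>i\<in>I. orbit_exp_sum G a x (gauss_vecs \<omega> i))}"
  shows "T \<in> sets (gauss_space n)"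
    and "measure (gauss_space n) T \<le> exp (- v) * (real (card G) / sqrt (1 - 2 * a)) ^ card I"
proof -
  interpret prob_space "gauss_space n :: ((nat \<times> 'd) \<Rightarrow> real) measure" by (rule prob_space_gauss_space)
  let ?M = "gauss_space n :: ((nat \<times> 'd) \<Rightarrow> real) measure"
  let ?F = "\<lambda>i \<omega>. orbit_exp_sum G a x (gauss_vecs \<omega> i)"
  have finI: "finite I" using I finite_subset by blast
  have pos: "0 \<le> ?F i \<omega>" for i \<omega> by (simp add: orbit_exp_sum_def sum_nonneg)
  have meas1: "(\<lambda>\<omega>. exp (a * (gauss_vecs \<omega> i \<bullet> w)\<^sup>2)) \<in> borel_measurable ?M" if "i \<in> I" for i w
  proof -
    have [measurable]: "(\<lambda>\<omega>. gauss_vecs \<omega> i \<bullet> w) \<in> borel_measurable ?M"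
      using I that by (intro gauss_inner_measurable) auto
    show ?thesis by measurable
  qed
  have meas: "?F i \<in> borel_measurable ?M" if "i \<in> I" for i
    unfolding orbit_exp_sum_def inner_matrix_transpose
    using that by (intro borel_measurable_sum meas1)
  then have meas_prod [measurable]: "(\<lambda>\<omega>. \<Prod>i\<in>I. ?F i \<omega>) \<in> borel_measurable ?M"
    by (intro borel_measurable_prod) auto
  show sets: "T \<in> sets ?M"
    unfolding T_def by measurable
  have norm_transpose: "norm (transpose g *v x) = 1" if "g \<in> G" for g
    using G x that norm_orthogonal_matrix_mult[of "transpose g" x]
    unfolding finite_orth_group_def by metis
  have exp1: "(\<integral>\<^sup>+\<omega>. ennreal (?F i \<omega>) \<partial>?M) = ennreal (real (card G) / sqrt (1 - 2 * a))"
    if i: "i \<in> I" for i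
  proof -
    have "(\<integral>\<^sup>+\<omega>. ennreal (?F i \<omega>) \<partial>?M)
      = (\<Sum>g\<in>G. \<integral>\<^sup>+\<omega>. ennreal (exp (a * (gauss_vecs \<omega> i \<bullet> (transpose g *v x))\<^sup>2)) \<partial>?M)"
      unfolding orbit_exp_sum_def inner_matrix_transpose
      using i I by (subst nn_integral_sum[symmetric])
        (auto intro!: meas1)
    also have "\<dots> = (\<Sum>g\<in>G. ennreal (1 / sqrt (1 - 2 * a)))"
      using i I a by (intro sum.cong refl gauss_exp_square norm_transpose) auto
    also have "\<dots> = ennreal (real (card G) / sqrt (1 - 2 * a))"
      using a by (simp add: ennreal_of_nat_eq_real_of_nat ennreal_mult[symmetric])
    finally show ?thesis .
  qed
  have "indep_vars (\<lambda>_. borel) (\<lambda>i \<omega>. ennreal (?F i \<omega>)) I"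
    unfolding orbit_exp_sum_def inner_matrix_transpose
    by (rule indep_vars_subset[OF gauss_vecs_indep I]) measurable
  then have "(\<integral>\<^sup>+\<omega>. (\<Prod>i\<in>I. ennreal (?F i \<omega>)) \<partial>?M) = (\<Prod>i\<in>I. \<integral>\<^sup>+\<omega>. ennreal (?F i \<omega>) \<partial>?M)"
    by (intro indep_vars_nn_integral finI) auto
  also have "\<dots> = ennreal (real (card G) / sqrt (1 - 2 * a)) ^ card I"
    by (simp add: exp1)
  finally have E: "(\<integral>\<^sup>+\<omega>. ennreal (\<Prod>i\<in>I. ?F i \<omega>) \<partial>?M)
      = ennreal ((real (card G) / sqrt (1 - 2 * a)) ^ card I)"
    using a by (simp add: prod_ennreal pos ennreal_power)
  have "emeasure ?M T \<le> emeasure ?M {\<omega>\<in>space ?M. 1 \<le> ennreal (exp (- v)) * ennreal (\<Prod>i\<in>I. ?F i \<omega>)}"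
  proof (rule emeasure_mono)
    show "T \<subseteq> {\<omega>\<in>space ?M. 1 \<le> ennreal (exp (- v)) * ennreal (\<Prod>i\<in>I. ?F i \<omega>)}"
      unfolding T_def
      by (auto simp: ennreal_mult[symmetric] prod_nonneg pos exp_minus field_simps)
    show "{\<omega>\<in>space ?M. 1 \<le> ennreal (exp (- v)) * ennreal (\<Prod>i\<in>I. ?F i \<omega>)} \<in> sets ?M"
      by measurable
  qed
  also have "\<dots> \<le> ennreal (exp (- v)) * (\<integral>\<^sup>+\<omega>. ennreal (\<Prod>i\<in>I. ?F i \<omega>) * indicator (space ?M) \<omega> \<partial>?M)"
    by (rule nn_integral_Markov_inequality) measurable
  also have "(\<integral>\<^sup>+\<omega>. ennreal (\<Prod>i\<in>I. ?F i \<omega>) * indicator (space ?M) \<omega> \<partial>?M)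
      = ennreal ((real (card G) / sqrt (1 - 2 * a)) ^ card I)"
    unfolding E[symmetric] by (rule nn_integral_cong) simp
  finally have "ennreal (measure ?M T) \<le> ennreal (exp (- v) * (real (card G) / sqrt (1 - 2 * a)) ^ card I)"
    using a by (simp add: emeasure_eq_measure ennreal_mult)
  then show "measure ?M T \<le> exp (- v) * (real (card G) / sqrt (1 - 2 * a)) ^ card I"
    using a by (subst (asm) ennreal_le_iff) auto
qed

section \<open>Orbits, Voronoi cells and the filter bank\<close>

text \<open>Finitely many hyperplanes with nonzero normals form a null set, so they cannot cover the
  space.\<close>

lemma avoid_finite_hyperplanes:
  fixes V :: "'a::euclidean_space set"
  assumes "finite V" "0 \<notin> V"
  obtains w where "\<And>v. v \<in> V \<Longrightarrow> v \<bullet> w \<noteq> 0"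
proof -
  have "negligible (\<Union>v\<in>V. {w. v \<bullet> w = 0})"
    using assms by (intro negligible_Union finite_imageI) (auto intro!: negligible_hyperplane)
  then have "(\<Union>v\<in>V. {w. v \<bullet> w = 0}) \<noteq> UNIV"
    using non_negligible_UNIV by metis
  with that show ?thesis by blast
qed

lemma finite_attains_max:
  fixes f :: "'a \<Rightarrow> real"
  assumes "finite P" "P \<noteq> {}"
  shows "\<exists>p\<in>P. \<forall>q\<in>P. f q \<le> f p"
proof -
  have "Max (f ` P) \<in> f ` P" using assms by (intro Max_in) auto
  then obtain p where "p \<in> P" "Max (f ` P) = f p" by auto
  then show ?thesis using assms(1) Max_ge[of "f ` P"] by (intro bexI[of _ p]) auto
qed

text \<open>Among the maximizers for \<open>z\<close>, one with the largest inner product with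
  \<open>w\<close> is chosen. Small moves along \<open>w\<close> keep the strict inequalities at
  \<open>z\<close> by continuity and break the ties in favour of this point.\<close>

lemma unique_maximizer_perturb:
  fixes P :: "'a::euclidean_space set"
  assumes P: "finite P" "P \<noteq> {}"
    and w: "\<And>p q. p \<in> P \<Longrightarrow> q \<in> P \<Longrightarrow> p \<noteq> q \<Longrightarrow> (p - q) \<bullet> w \<noteq> 0"
  obtains p where "p \<in> P" "\<And>q. q \<in> P \<Longrightarrow> q \<bullet> z \<le> p \<bullet> z"
    "eventually (\<lambda>\<delta>. \<forall>q\<in>P. q \<noteq> p \<longrightarrow> q \<bullet> (z + \<delta> *\<^sub>R w) < p \<bullet> (z + \<delta> *\<^sub>R w)) (at_right 0)"
proof -
  define Q where "Q = {p\<in>P. \<forall>q\<in>P. q \<bullet> z \<le> p \<bullet> z}"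
  obtain p0 where "p0 \<in> P" "\<And>q. q \<in> P \<Longrightarrow> q \<bullet> z \<le> p0 \<bullet> z"
    using finite_attains_max[OF P, of "\<lambda>p. p \<bullet> z"] by blast
  then have "Q \<noteq> {}" "finite Q" using P by (auto simp: Q_def)
  then obtain p where p: "p \<in> Q" "\<And>q. q \<in> Q \<Longrightarrow> q \<bullet> w \<le> p \<bullet> w"
    using finite_attains_max[of Q "\<lambda>p. p \<bullet> w"] by blast
  have "eventually (\<lambda>\<delta>. q \<noteq> p \<longrightarrow> q \<bullet> (z + \<delta> *\<^sub>R w) < p \<bullet> (z + \<delta> *\<^sub>R w)) (at_right 0)"
    if q: "q \<in> P" for q
  proof (cases "q \<bullet> z < p \<bullet> z")
    case True
    have "((\<lambda>\<delta>. (p - q) \<bullet> (z + \<delta> *\<^sub>R w)) \<longlongrightarrow> (p - q) \<bullet> (z + 0 *\<^sub>R w)) (at_right 0)"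
      by (intro tendsto_intros)
    moreover have "0 < (p - q) \<bullet> (z + 0 *\<^sub>R w)" using True by (simp add: inner_diff_left)
    ultimately have "eventually (\<lambda>\<delta>. 0 < (p - q) \<bullet> (z + \<delta> *\<^sub>R w)) (at_right 0)"
      by (rule order_tendstoD)
    then show ?thesis by eventually_elim (simp add: inner_diff_left)
  next
    case False
    then have eq: "q \<bullet> z = p \<bullet> z" using p(1) q by (force simp: Q_def)
    then have "q \<in> Q" using p(1) q by (auto simp: Q_def)
    show ?thesis
    proof (rule eventually_at_right_less[of 0, THEN eventually_mono], intro impI)
      fix \<delta> :: real assume \<delta>: "0 < \<delta>" and "q \<noteq> p"
      then have "q \<bullet> w < p \<bullet> w"
        using p(2)[OF \<open>q \<in> Q\<close>] w[of p q] q p(1) by (force simp: Q_def inner_diff_left)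
      with \<delta> eq show "q \<bullet> (z + \<delta> *\<^sub>R w) < p \<bullet> (z + \<delta> *\<^sub>R w)"
        by (simp add: inner_add_right)
    qed
  qed
  then have "eventually (\<lambda>\<delta>. \<forall>q\<in>P. q \<noteq> p \<longrightarrow> q \<bullet> (z + \<delta> *\<^sub>R w) < p \<bullet> (z + \<delta> *\<^sub>R w)) (at_right 0)"
    using P(1) by (simp add: eventually_ball_finite_distrib)
  with that[of p] p(1) show ?thesis by (auto simp: Q_def)
qed

section \<open>Group action, orbit distance and max filters\<close>

context
  fixes G :: "(real^'d^'d) set"
  assumes G: "finite_orth_group G"
begin

lemma finite_group: "finite G"
  and one_mem: "mat 1 \<in> G"
  and mult_mem: "g \<in> G \<Longrightarrow> h \<in> G \<Longrightarrow> g ** h \<in> G"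
  and transpose_mem: "g \<in> G \<Longrightarrow> transpose g \<in> G"
  and orthogonal_mem: "g \<in> G \<Longrightarrow> orthogonal_matrix g"
  using G by (auto simp: finite_orth_group_def)

lemma card_group_ge_1: "1 \<le> real (card G)"
proof -
  have "card G \<noteq> 0" using finite_group one_mem by auto
  then show ?thesis by simp
qed

lemma transpose_cancel:
  assumes "g \<in> G"
  shows "transpose g *v (g *v x) = x" "g *v (transpose g *v x) = x"
  using orthogonal_mem[OF assms] by (auto simp: orthogonal_matrix_def matrix_vector_mul_assoc simp del: transpose_matrix_vector)

lemma inner_group: "g \<in> G \<Longrightarrow> (g *v x) \<bullet> (g *v y) = x \<bullet> y"
  by (metis inner_matrix_transpose transpose_cancel(1))

lemma finite_orbit: "finite (orbit G x)"
  using finite_group by (simp add: orbit_def)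

lemma self_mem_orbit: "x \<in> orbit G x"
  using one_mem by (force simp: orbit_def)

lemma orbit_act: "g \<in> G \<Longrightarrow> p \<in> orbit G x \<Longrightarrow> g *v p \<in> orbit G x"
  by (auto simp: orbit_def matrix_vector_mul_assoc intro!: imageI mult_mem)

lemma orbit_eq: "g \<in> G \<Longrightarrow> orbit G (g *v x) = orbit G x"
proof
  assume g: "g \<in> G"
  show "orbit G (g *v x) \<subseteq> orbit G x"
    using g by (auto simp: orbit_def matrix_vector_mul_assoc intro!: imageI mult_mem)
  show "orbit G x \<subseteq> orbit G (g *v x)"
  proof
    fix p assume "p \<in> orbit G x"
    then obtain h where h: "h \<in> G" "p = h *v x" by (auto simp: orbit_def)
    then have "p = (h ** transpose g) *v (g *v x)"
      using transpose_cancel(1)[OF g, of x] by (simp flip: matrix_vector_mul_assoc)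
    then show "p \<in> orbit G (g *v x)"
      using h g by (auto simp: orbit_def intro!: imageI mult_mem transpose_mem)
  qed
qed

lemma finite_orbit_pairs: "finite {f p q | p q. p \<in> orbit G x \<and> q \<in> orbit G y}"
  using finite_image_set2[of "\<lambda>p. p \<in> orbit G x" "\<lambda>q. q \<in> orbit G y" f] finite_orbit by simp

lemma orbit_dist_le: "p \<in> orbit G x \<Longrightarrow> q \<in> orbit G y \<Longrightarrow> orbit_dist G x y \<le> norm (p - q)"
  unfolding orbit_dist_def by (rule Min_le[OF finite_orbit_pairs]) auto

text \<open>The inverse \<open>transpose g\<close> moves a minimizing pair so that its first point
  becomes \<open>x\<close>, without changing distances.\<close>

lemma orbit_dist_attained: "\<exists>q\<in>orbit G y. orbit_dist G x y = norm (x - q)"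
proof -
  have "orbit_dist G x y \<in> {norm (p - q) | p q. p \<in> orbit G x \<and> q \<in> orbit G y}"
    unfolding orbit_dist_def using self_mem_orbit by (intro Min_in finite_orbit_pairs) auto
  then obtain g q where gq: "g \<in> G" "q \<in> orbit G y" "orbit_dist G x y = norm (g *v x - q)"
    by (auto simp: orbit_def[of G x])
  have "norm (g *v x - q) = norm (transpose g *v (g *v x - q))"
    by (rule norm_orthogonal_matrix_mult[symmetric]) (rule orthogonal_mem[OF transpose_mem[OF gq(1)]])
  also have "transpose g *v (g *v x - q) = x - transpose g *v q"
    unfolding matrix_vector_mult_diff_distrib transpose_cancel(1)[OF gq(1)] ..
  finally show ?thesis
    using gq orbit_act[OF transpose_mem[OF gq(1)] gq(2)] by metis
qed

text \<open>The translate that is optimal for \<open>x'\<close> and \<open>y'\<close> is tested on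
  \<open>x\<close> and \<open>y\<close>. This is used to pass to the limit from principal
  points.\<close>

lemma orbit_dist_perturb:
  "orbit_dist G x y \<le> orbit_dist G x' y' + norm (x - x') + norm (y - y')"
proof -
  obtain h where h: "h \<in> G" "orbit_dist G x' y' = norm (x' - h *v y')"
    using orbit_dist_attained[of y' x'] by (auto simp: orbit_def)
  have "orbit_dist G x y \<le> norm (x - h *v y)"
    using h(1) self_mem_orbit by (intro orbit_dist_le) (auto simp: orbit_def)
  also have "x - h *v y = (x' - h *v y') + (x - x') - h *v (y - y')"
    by (simp add: matrix_vector_mult_diff_distrib)
  also have "norm \<dots> \<le> norm (x' - h *v y') + norm (x - x') + norm (h *v (y - y'))"
    by (meson norm_triangle_ineq norm_triangle_ineq4 order_trans add_right_mono)
  also have "norm (h *v (y - y')) = norm (y - y')"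
    using h(1) orthogonal_mem by (simp add: norm_orthogonal_matrix_mult)
  finally show ?thesis using h(2) by simp
qed

lemma max_filter_ge: "p \<in> orbit G z \<Longrightarrow> q \<in> orbit G x \<Longrightarrow> p \<bullet> q \<le> max_filter G z x"
  unfolding max_filter_def by (rule Max_ge[OF finite_orbit_pairs]) auto

lemma max_filter_le:
  assumes "\<And>q. q \<in> orbit G x \<Longrightarrow> z \<bullet> q \<le> c"
  shows "max_filter G z x \<le> c"
  unfolding max_filter_def
proof (rule Max.boundedI[OF finite_orbit_pairs])
  show "{p \<bullet> q |p q. p \<in> orbit G z \<and> q \<in> orbit G x} \<noteq> {}" using self_mem_orbit by blast
  fix a assume "a \<in> {p \<bullet> q |p q. p \<in> orbit G z \<and> q \<in> orbit G x}"
  then obtain g q where "g \<in> G" "q \<in> orbit G x" "a = (g *v z) \<bullet> q" by (auto simp: orbit_def[of G z])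
  then show "a \<le> c"
    using assms[OF orbit_act[OF transpose_mem]] by (simp only: inner_matrix_transpose)
qed

lemma max_filter_eqI:
  assumes "p \<in> orbit G x" "\<And>q. q \<in> orbit G x \<Longrightarrow> z \<bullet> q \<le> z \<bullet> p"
  shows "max_filter G z x = z \<bullet> p"
  using max_filter_le[OF assms(2)] max_filter_ge[OF self_mem_orbit assms(1), of z]
  by (intro antisym)

lemma max_filter_attained: "\<exists>g\<in>G. max_filter G z x = (g *v z) \<bullet> x"
proof -
  have "max_filter G z x \<in> {p \<bullet> q | p q. p \<in> orbit G z \<and> q \<in> orbit G x}"
    unfolding max_filter_def using self_mem_orbit by (intro Max_in finite_orbit_pairs) auto
  then obtain g h where gh: "g \<in> G" "h \<in> G" "max_filter G z x = (h *v x) \<bullet> (g *v z)"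
    by (auto simp: orbit_def inner_commute)
  then have "max_filter G z x = ((transpose h ** g) *v z) \<bullet> x"
    by (metis inner_matrix_transpose matrix_vector_mul_assoc inner_commute)
  then show ?thesis using gh mult_mem transpose_mem by blast
qed

lemma max_filter_orbit:
  assumes "p \<in> orbit G x" shows "max_filter G z p = max_filter G z x"
  using assms orbit_eq by (auto simp: max_filter_def orbit_def[of G x])

text \<open>A translate attaining the larger value competes for the smaller one as well, so the
  difference is at most its inner product with \<open>x - y\<close>, up to sign.\<close>

lemma max_filter_diff_le:
  "\<exists>g\<in>G. \<bar>max_filter G z x - max_filter G z y\<bar> \<le> \<bar>(g *v z) \<bullet> (x - y)\<bar>"
proof -
  have one_side: "\<exists>g\<in>G. max_filter G z x - max_filter G z y \<le> \<bar>(g *v z) \<bullet> (x - y)\<bar>" for x y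
  proof -
    obtain g where g: "g \<in> G" "max_filter G z x = (g *v z) \<bullet> x" using max_filter_attained by blast
    have "(g *v z) \<bullet> y \<le> max_filter G z y"
      using g(1) self_mem_orbit by (intro max_filter_ge) (auto simp: orbit_def)
    then show ?thesis using g by (intro bexI[of _ g]) (auto simp: inner_diff_right)
  qed
  show ?thesis
  proof (cases "max_filter G z y \<le> max_filter G z x")
    case True then show ?thesis using one_side[of x y] by auto
  next
    case False
    with one_side[of y x] show ?thesis by (auto simp: inner_diff_right abs_minus_commute)
  qed
qed

lemma max_filter_lipschitz: "\<bar>max_filter G z x - max_filter G z y\<bar> \<le> norm z * norm (x - y)"
proof -
  obtain g where g: "g \<in> G" and "\<bar>max_filter G z x - max_filter G z y\<bar> \<le> \<bar>(g *v z) \<bullet> (x - y)\<bar>"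
    using max_filter_diff_le by blast
  note this(2)
  also have "\<dots> \<le> norm (g *v z) * norm (x - y)" by (rule Cauchy_Schwarz_ineq2)
  finally show ?thesis using g orthogonal_mem by (simp add: norm_orthogonal_matrix_mult)
qed

text \<open>Group elements are isometries that permute orbits, so they carry cells to cells.\<close>

lemma voronoi_act: "g \<in> G \<Longrightarrow> w \<in> voronoi G x \<Longrightarrow> g *v w \<in> voronoi G (g *v x)"
  unfolding voronoi_def
proof (safe, goal_cases)
  case (1 p)
  have p: "transpose g *v p \<in> orbit G x"
    using 1 orbit_eq orbit_act transpose_mem by metis
  have "transpose g *v p \<noteq> x" using 1 transpose_cancel(2)[OF 1(1), of p] by auto
  then have "(transpose g *v p) \<bullet> w < x \<bullet> w" using 1(2) p by blast
  then show ?case using inner_group[OF 1(1)] transpose_cancel(2)[OF 1(1), of p] by metis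
qed

text \<open>
  The maximizers for \<open>z\<close> need not be unique. Moving \<open>z\<close> slightly in a generic direction selects
  maximizers of \<open>z\<close> whose open Voronoi cells meet.
\<close>
lemma max_filter_pair_selection:
  assumes "x \<in> principal G" "y \<in> principal G"
  obtains h q where "h \<in> G" "q \<in> S_set G x y"
    "max_filter G z x - max_filter G z y = (h *v z) \<bullet> (x - q)"
proof -
  let ?D = "\<lambda>x. {p - q | p q. p \<in> orbit G x \<and> q \<in> orbit G x} - {0}"
  have "finite (?D x \<union> ?D y)" using finite_orbit_pairs[of "(-)"] by auto
  then obtain w where w: "\<And>v. v \<in> ?D x \<union> ?D y \<Longrightarrow> v \<bullet> w \<noteq> 0"
    using avoid_finite_hyperplanes[of "?D x \<union> ?D y"] by blast
  have ne: "orbit G x \<noteq> {}" "orbit G y \<noteq> {}" using self_mem_orbit by blast+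
  obtain p where p: "p \<in> orbit G x" "\<And>q. q \<in> orbit G x \<Longrightarrow> q \<bullet> z \<le> p \<bullet> z"
    "eventually (\<lambda>\<delta>. \<forall>q\<in>orbit G x. q \<noteq> p \<longrightarrow> q \<bullet> (z + \<delta> *\<^sub>R w) < p \<bullet> (z + \<delta> *\<^sub>R w)) (at_right 0)"
    by (rule unique_maximizer_perturb[OF finite_orbit ne(1), of w z])
       (rule w, auto)
  obtain q where q: "q \<in> orbit G y" "\<And>p. p \<in> orbit G y \<Longrightarrow> p \<bullet> z \<le> q \<bullet> z"
    "eventually (\<lambda>\<delta>. \<forall>p\<in>orbit G y. p \<noteq> q \<longrightarrow> p \<bullet> (z + \<delta> *\<^sub>R w) < q \<bullet> (z + \<delta> *\<^sub>R w)) (at_right 0)"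
    by (rule unique_maximizer_perturb[OF finite_orbit ne(2), of w z])
       (rule w, auto)
  obtain \<delta> :: real where \<delta>: "\<forall>q\<in>orbit G x. q \<noteq> p \<longrightarrow> q \<bullet> (z + \<delta> *\<^sub>R w) < p \<bullet> (z + \<delta> *\<^sub>R w)"
      "\<forall>p\<in>orbit G y. p \<noteq> q \<longrightarrow> p \<bullet> (z + \<delta> *\<^sub>R w) < q \<bullet> (z + \<delta> *\<^sub>R w)"
    using eventually_happens'[OF trivial_limit_at_right_real eventually_conj[OF p(3) q(3)]] by blast
  obtain g where g: "g \<in> G" "p = g *v x" using p(1) by (auto simp: orbit_def)
  obtain k where k: "k \<in> G" "q = k *v y" using q(1) by (auto simp: orbit_def)
  \<comment> \<open>The inverse of \<open>g\<close> carries the selected maximizer \<open>p\<close>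
    to \<open>x\<close>. Voronoi cells move along, so the perturbed vector witnesses
    \<open>h *v q \<in> S_set G x y\<close>.\<close>
  define h where "h = transpose g"
  have h: "h \<in> G" "h *v p = x" using g transpose_mem transpose_cancel(1) by (auto simp: h_def simp del: transpose_matrix_vector)
  let ?z = "z + \<delta> *\<^sub>R w"
  have "?z \<in> voronoi G p" "?z \<in> voronoi G q"
    using \<delta> g k orbit_eq by (auto simp: voronoi_def)
  then have "h *v ?z \<in> voronoi G x" "h *v ?z \<in> voronoi G (h *v q)"
    using voronoi_act[OF h(1)] h(2) by metis+
  then have S: "h *v q \<in> S_set G x y"
    using orbit_act[OF h(1) q(1)] by (auto simp: S_set_def)
  have "max_filter G z x = z \<bullet> p" "max_filter G z y = z \<bullet> q"
    using max_filter_eqI[OF p(1), of z] max_filter_eqI[OF q(1), of z] p(2) q(2)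
    by (metis inner_commute)+
  then have "max_filter G z x - max_filter G z y = (h *v z) \<bullet> (h *v p) - (h *v z) \<bullet> (h *v q)"
    by (simp add: inner_group[OF h(1)])
  then show ?thesis
    using that[OF h(1) S] h(2) by (simp add: inner_diff_right)
qed

text \<open>A direction \<open>w\<close> with trivial stabilizer works at every \<open>x\<close>: if
  \<open>g\<close> fixes \<open>x\<close>, it moves \<open>w\<close>; if it moves \<open>x\<close>,
  it still moves all nearby points.\<close>

lemma principal_perturb:
  "\<exists>w. \<forall>x. eventually (\<lambda>\<delta>. x + \<delta> *\<^sub>R w \<in> principal G) (at_right 0)"
proof -
  have "\<exists>v. transpose g *v v \<noteq> v" if "g \<in> G" "g \<noteq> mat 1" for g
  proof (rule ccontr)
    assume "\<nexists>v. transpose g *v v \<noteq> v"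
    then have "transpose g = mat 1" by (simp add: matrix_eq del: transpose_matrix_vector)
    then have "g = mat 1" by (metis transpose_mat transpose_transpose)
    with that show False by simp
  qed
  then obtain v where v: "\<And>g. g \<in> G \<Longrightarrow> g \<noteq> mat 1 \<Longrightarrow> transpose g *v v g - v g \<noteq> 0"
    by (metis eq_iff_diff_eq_0)
  \<comment> \<open>Every fixed vector of \<open>g\<close> is orthogonal to \<open>u g\<close>, so
    avoiding these hyperplanes makes the stabilizer of \<open>w\<close> trivial.\<close>
  define u where "u g = transpose g *v v g - v g" for g
  have "finite (u ` (G - {mat 1}))" using finite_group by simp
  moreover have "0 \<notin> u ` (G - {mat 1})" using v unfolding u_def[symmetric] by force
  ultimately obtain w where w: "\<And>a. a \<in> u ` (G - {mat 1}) \<Longrightarrow> a \<bullet> w \<noteq> 0"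
    using avoid_finite_hyperplanes[of "u ` (G - {mat 1})"] by blast
  have gw: "g *v w \<noteq> w" if "g \<in> G" "g \<noteq> mat 1" for g
  proof
    assume gw: "g *v w = w"
    have "(transpose g *v v g) \<bullet> w = v g \<bullet> (g *v w)"
      using inner_matrix_transpose[of g w "v g"] by (simp only: inner_commute)
    then have "u g \<bullet> w = 0"
      unfolding u_def gw by (simp only: inner_diff_left)
    moreover have "u g \<in> u ` (G - {mat 1})" using that by blast
    ultimately show False using w by blast
  qed
  have "eventually (\<lambda>\<delta>. x + \<delta> *\<^sub>R w \<in> principal G) (at_right 0)" for x
  proof -
    have "eventually (\<lambda>\<delta>. g *v (x + \<delta> *\<^sub>R w) \<noteq> x + \<delta> *\<^sub>R w) (at_right 0)"
      if g: "g \<in> G - {mat 1}" for g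
    proof (cases "g *v x = x")
      case True
      show ?thesis
      proof (rule eventually_at_right_less[of 0, THEN eventually_mono])
        fix \<delta> :: real assume "0 < \<delta>"
        with True gw g show "g *v (x + \<delta> *\<^sub>R w) \<noteq> x + \<delta> *\<^sub>R w"
          by (simp add: matrix_vector_right_distrib matrix_vector_mult_scaleR)
      qed
    next
      case False
      have "((\<lambda>\<delta>. (g *v x - x) + \<delta> *\<^sub>R (g *v w - w)) \<longlongrightarrow> (g *v x - x) + 0 *\<^sub>R (g *v w - w)) (at_right 0)"
        by (intro tendsto_intros)
      then have "eventually (\<lambda>\<delta>. (g *v x - x) + \<delta> *\<^sub>R (g *v w - w) \<noteq> 0) (at_right 0)"
        using False by (intro tendsto_imp_eventually_ne) auto
      then show ?thesis
        by eventually_elim (auto simp: matrix_vector_right_distrib matrix_vector_mult_scaleR algebra_simps)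
    qed
    then have "eventually (\<lambda>\<delta>. \<forall>g\<in>G - {mat 1}. g *v (x + \<delta> *\<^sub>R w) \<noteq> x + \<delta> *\<^sub>R w) (at_right 0)"
      using finite_group by (simp add: eventually_ball_finite_distrib)
    then show ?thesis
      by eventually_elim (use one_mem in \<open>auto simp: principal_def stab_def\<close>)
  qed
  then show ?thesis by blast
qed

text \<open>\<open>chi\<close> is a \<open>Max\<close> over infinitely many pairs. It bounds its
  members because all these cardinalities lie in \<open>{..card G}\<close>, which makes the set
  finite.\<close>

lemma card_S_set_le_chi:
  assumes "x \<in> principal G" "y \<in> principal G"
  shows "card (S_set G x y) \<le> chi G"
proof -
  have "card (S_set G x y) \<le> card G" for x y
  proof -
    have "card (S_set G x y) \<le> card (orbit G y)"
      by (intro card_mono finite_orbit) (auto simp: S_set_def)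
    also have "\<dots> \<le> card G" unfolding orbit_def using finite_group by (rule card_image_le)
    finally show ?thesis .
  qed
  then have "{card (S_set G x y) | x y. x \<in> principal G \<and> y \<in> principal G} \<subseteq> {..card G}" by auto
  then have "finite {card (S_set G x y) | x y. x \<in> principal G \<and> y \<in> principal G}"
    using finite_subset by blast
  then show ?thesis unfolding chi_def using assms by (intro Max_ge) auto
qed

section \<open>Bi-Lipschitz bounds for the filter bank\<close>

lemma dist_n_eq_L2_set: "dist_n n u v = L2_set (\<lambda>i. u i - v i) {..<n}"
  by (simp add: dist_n_def L2_set_def)

text \<open>After \<open>y\<close> is replaced by its orbit point nearest to \<open>x\<close>, each
  coordinate difference is controlled by one translate of \<open>z i\<close>. These translates form
  one admissible \<open>h\<close>.\<close>

lemma max_filter_bank_upper: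
  assumes b: "\<And>h x. (\<And>i. i < n \<Longrightarrow> h i \<in> G) \<Longrightarrow> L2_set (\<lambda>i. (h i *v z i) \<bullet> x) {..<n} \<le> b * norm x"
  shows "dist_n n (max_filter_bank G n z x) (max_filter_bank G n z y) \<le> b * orbit_dist G x y"
proof -
  obtain q where q: "q \<in> orbit G y" "orbit_dist G x y = norm (x - q)"
    using orbit_dist_attained by blast
  have "\<exists>g. g \<in> G \<and> \<bar>max_filter G (z i) x - max_filter G (z i) q\<bar> \<le> \<bar>(g *v z i) \<bullet> (x - q)\<bar>" for i
    using max_filter_diff_le by blast
  then obtain h where h: "\<And>i. h i \<in> G"
    "\<And>i. \<bar>max_filter G (z i) x - max_filter G (z i) q\<bar> \<le> \<bar>(h i *v z i) \<bullet> (x - q)\<bar>"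
    by metis
  have "dist_n n (max_filter_bank G n z x) (max_filter_bank G n z y)
    = L2_set (\<lambda>i. \<bar>max_filter G (z i) x - max_filter G (z i) q\<bar>) {..<n}"
    unfolding dist_n_eq_L2_set max_filter_orbit[OF q(1)]
    by (simp add: L2_set_def max_filter_bank_def)
  also have "\<dots> \<le> L2_set (\<lambda>i. \<bar>(h i *v z i) \<bullet> (x - q)\<bar>) {..<n}"
    by (intro L2_set_mono h) auto
  also have "\<dots> = L2_set (\<lambda>i. (h i *v z i) \<bullet> (x - q)) {..<n}" by (simp add: L2_set_def)
  also have "\<dots> \<le> b * norm (x - q)" using h by (intro b)
  finally show ?thesis using q by simp
qed

text \<open>The selected points \<open>q i\<close> take at most \<open>chi G\<close> values, so one
  value \<open>p\<close> occurs in at least \<open>k\<close> rows. Discarding the other rows only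
  shrinks the norm, and \<open>norm (x - p)\<close> is at least the orbit distance because
  \<open>p\<close> lies in the orbit of \<open>y\<close>.\<close>

lemma max_filter_bank_lower_principal:
  assumes t: "0 \<le> t"
    and k: "\<And>j. n \<le> j * chi G \<Longrightarrow> k \<le> j"
    and low: "\<And>I h x. I \<subseteq> {..<n} \<Longrightarrow> card I = k \<Longrightarrow> (\<And>i. i \<in> I \<Longrightarrow> h i \<in> G) \<Longrightarrow>
      t * norm x \<le> L2_set (\<lambda>i. (h i *v z i) \<bullet> x) I"
    and xy: "x \<in> principal G" "y \<in> principal G"
  shows "t * orbit_dist G x y \<le> dist_n n (max_filter_bank G n z x) (max_filter_bank G n z y)"
proof -
  have "\<exists>g p. g \<in> G \<and> p \<in> S_set G x y \<and>
      max_filter G (z i) x - max_filter G (z i) y = (g *v z i) \<bullet> (x - p)" for i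
    using max_filter_pair_selection[OF xy] by blast
  then obtain h q where h: "\<And>i. h i \<in> G" and q: "\<And>i. q i \<in> S_set G x y"
    and eq: "\<And>i. max_filter G (z i) x - max_filter G (z i) y = (h i *v z i) \<bullet> (x - q i)"
    by metis
  have S: "S_set G x y \<subseteq> orbit G y" by (auto simp: S_set_def)
  then have finS: "finite (S_set G x y)" using finite_orbit finite_subset by blast
  obtain p where p: "p \<in> S_set G x y" "n \<le> card (q -` {p} \<inter> {..<n}) * card (S_set G x y)"
    using pigeonhole_card[of q "{..<n}" "S_set G x y"] q finS by auto
  have "k \<le> card (q -` {p} \<inter> {..<n})"
    using p(2) mult_le_mono2[OF card_S_set_le_chi[OF xy]] by (intro k) (rule order_trans)
  then obtain I where I: "I \<subseteq> q -` {p} \<inter> {..<n}" "card I = k"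
    by (rule obtain_subset_with_card_n)
  have "t * orbit_dist G x y \<le> t * norm (x - p)"
    using p(1) S self_mem_orbit t by (intro mult_left_mono orbit_dist_le) auto
  also have "\<dots> \<le> L2_set (\<lambda>i. (h i *v z i) \<bullet> (x - p)) I"
    using I h by (intro low) auto
  also have "\<dots> = L2_set (\<lambda>i. max_filter G (z i) x - max_filter G (z i) y) I"
    using I(1) by (intro L2_set_cong refl) (auto simp: eq)
  also have "\<dots> \<le> L2_set (\<lambda>i. max_filter G (z i) x - max_filter G (z i) y) {..<n}"
    unfolding L2_set_def using I(1) by (intro real_sqrt_le_mono sum_mono2) auto
  also have "\<dots> = dist_n n (max_filter_bank G n z x) (max_filter_bank G n z y)"
    by (simp add: dist_n_def L2_set_def max_filter_bank_def)
  finally show ?thesis .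
qed

text \<open>Both points are moved to principal ones along a common direction \<open>w\<close>, and
  the inequality is passed to the limit.\<close>

lemma max_filter_bank_lower:
  assumes t: "0 \<le> t"
    and k: "\<And>j. n \<le> j * chi G \<Longrightarrow> k \<le> j"
    and low: "\<And>I h x. I \<subseteq> {..<n} \<Longrightarrow> card I = k \<Longrightarrow> (\<And>i. i \<in> I \<Longrightarrow> h i \<in> G) \<Longrightarrow>
      t * norm x \<le> L2_set (\<lambda>i. (h i *v z i) \<bullet> x) I"
  shows "t * orbit_dist G x y \<le> dist_n n (max_filter_bank G n z x) (max_filter_bank G n z y)"
proof -
  obtain w where w: "\<And>x. eventually (\<lambda>\<delta>. x + \<delta> *\<^sub>R w \<in> principal G) (at_right 0)"
    using principal_perturb by blast
  have mf: "((\<lambda>\<delta>. max_filter G v (x + \<delta> *\<^sub>R w)) \<longlongrightarrow> max_filter G v x) (at_right 0)" for v x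
  proof -
    have "((\<lambda>\<delta>. norm v * norm (\<delta> *\<^sub>R w)) \<longlongrightarrow> norm v * norm (0 *\<^sub>R w)) (at_right 0)"
      by (intro tendsto_intros)
    then have lim: "((\<lambda>\<delta>. norm v * norm (\<delta> *\<^sub>R w)) \<longlongrightarrow> 0) (at_right 0)" by simp
    have "eventually (\<lambda>\<delta>. norm (max_filter G v (x + \<delta> *\<^sub>R w) - max_filter G v x) \<le> norm v * norm (\<delta> *\<^sub>R w)) (at_right 0)"
      using max_filter_lipschitz[of v "x + _ *\<^sub>R w" x] by (intro always_eventually) simp
    then have "((\<lambda>\<delta>. max_filter G v (x + \<delta> *\<^sub>R w) - max_filter G v x) \<longlongrightarrow> 0) (at_right 0)"
      using lim by (rule Lim_null_comparison)
    then show ?thesis by (simp add: LIM_zero_iff)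
  qed
  \<comment> \<open>The second summand pays for the change of \<open>orbit_dist\<close> and vanishes
    with \<open>\<delta>\<close>.\<close>
  let ?F = "\<lambda>\<delta>. dist_n n (max_filter_bank G n z (x + \<delta> *\<^sub>R w)) (max_filter_bank G n z (y + \<delta> *\<^sub>R w))
      + t * (norm (\<delta> *\<^sub>R w) + norm (\<delta> *\<^sub>R w))"
  have dist_eq: "dist_n n (max_filter_bank G n z u) (max_filter_bank G n z v)
      = sqrt (\<Sum>i<n. (max_filter G (z i) u - max_filter G (z i) v)\<^sup>2)" for u v
    by (simp add: dist_n_def max_filter_bank_def)
  have "(?F \<longlongrightarrow> dist_n n (max_filter_bank G n z x) (max_filter_bank G n z y) + t * (norm (0 *\<^sub>R w) + norm (0 *\<^sub>R w)))
    (at_right 0)"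
    unfolding dist_eq by (intro tendsto_intros mf)
  moreover have "eventually (\<lambda>\<delta>. t * orbit_dist G x y \<le> ?F \<delta>) (at_right 0)"
    using w[of x] w[of y]
  proof eventually_elim
    case (elim \<delta>)
    have "orbit_dist G x y \<le> orbit_dist G (x + \<delta> *\<^sub>R w) (y + \<delta> *\<^sub>R w) + norm (\<delta> *\<^sub>R w) + norm (\<delta> *\<^sub>R w)"
      using orbit_dist_perturb[of x y "x + \<delta> *\<^sub>R w" "y + \<delta> *\<^sub>R w"] by simp
    then have "t * orbit_dist G x y \<le> t * (orbit_dist G (x + \<delta> *\<^sub>R w) (y + \<delta> *\<^sub>R w) + norm (\<delta> *\<^sub>R w) + norm (\<delta> *\<^sub>R w))"
      using t by (rule mult_left_mono)
    also have "\<dots> = t * orbit_dist G (x + \<delta> *\<^sub>R w) (y + \<delta> *\<^sub>R w) + t * (norm (\<delta> *\<^sub>R w) + norm (\<delta> *\<^sub>R w))"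
      by (simp add: algebra_simps)
    also have "\<dots> \<le> ?F \<delta>"
      using max_filter_bank_lower_principal[OF t k low elim] by (intro add_right_mono) auto
    finally show ?case .
  qed
  ultimately have "t * orbit_dist G x y \<le> dist_n n (max_filter_bank G n z x) (max_filter_bank G n z y) + t * (norm (0 *\<^sub>R w) + norm (0 *\<^sub>R w))"
    by (intro tendsto_lowerbound[of ?F]) auto
  then show ?thesis by simp
qed

lemma distortion_le:
  assumes t: "0 < t" and b: "0 \<le> b"
    and low: "\<And>x y. t * orbit_dist G x y \<le> dist_n n (f x) (f y)"
    and up: "\<And>x y. dist_n n (f x) (f y) \<le> b * orbit_dist G x y"
  shows "distortion G n f \<le> ereal (b / t)"
proof -
  have l: "ereal t \<le> lower_lip G n f"
    unfolding lower_lip_def using low t by (intro Sup_upper) auto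
  have u: "upper_lip G n f \<le> ereal b"
    unfolding upper_lip_def using up b by (intro Inf_lower) auto
  have u0: "0 \<le> upper_lip G n f"
    unfolding upper_lip_def by (intro Inf_greatest) auto
  have "distortion G n f = upper_lip G n f / lower_lip G n f"
    using l u t by (auto simp: distortion_def)
  \<comment> \<open>Antitonicity in the denominator is applied with a positive numerator, so a zero
    upper constant is split off.\<close>
  also have "\<dots> \<le> upper_lip G n f / ereal t"
  proof (cases "upper_lip G n f = 0")
    case False
    have "0 < lower_lip G n f" using l t by (metis ereal_less(2) less_le_trans)
    then show ?thesis using l u0 t False by (intro ereal_divide_left_mono) (auto simp: ereal_zero_less_0_iff)
  qed simp
  also have "\<dots> \<le> ereal b / ereal t"
    using u t by (intro ereal_divide_right_mono) auto
  finally show ?thesis using t by simp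
qed

end

section \<open>Numerical estimates\<close>

text \<open>\<open>real k ^ k / fact k\<close> is a single term of the exponential series at
  \<open>k\<close>, which bounds the factorial from below.\<close>

lemma binomial_le_exp_power:
  assumes "0 < k"
  shows "real (n choose k) \<le> (exp 1 * real n / real k) ^ k"
proof -
  have "real k ^ k / fact k \<le> exp (real k)"
    using sum_le_suminf[OF sums_summable[OF exp_converges], of "{k}" "real k"]
      sums_unique[OF exp_converges, of "real k"]
    by (simp add: divide_inverse mult.commute)
  then have fact: "real k ^ k / exp (real k) \<le> fact k"
    by (simp add: field_simps)
  have "real (n choose k) * fact k \<le> real n ^ k"
    using binomial_fact_pow[of n k] by (metis of_nat_fact of_nat_le_iff of_nat_mult of_nat_power)
  then have "real (n choose k) \<le> real n ^ k / fact k" by (simp add: field_simps)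
  also have "\<dots> \<le> real n ^ k / (real k ^ k / exp (real k))"
    using fact assms by (intro divide_left_mono) auto
  also have "\<dots> = (exp 1 * real n / real k) ^ k"
    by (simp add: power_divide power_mult_distrib exp_of_nat_mult[symmetric] mult.commute)
  finally show ?thesis .
qed

text \<open>For \<open>s = sqrt lam\<close> and \<open>c\<close> the coefficient of
  \<open>1 / s\<close> in \<open>p\<close>, the first inequality says
  \<open>2 + (s + 2) / (lam - 1) \<le> c\<close>. The quotient decreases in \<open>s\<close>, so its
  value at \<open>lambda0\<close> serves as the constant.\<close>

lemma exponent_bound:
  fixes lam lambda0 :: real
  assumes "lambda0 > 1" "lam \<ge> lambda0"
  defines "p \<equiv> 1 + (2 + (sqrt lambda0 + 2) / (lambda0 - 1)) / sqrt lam"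
  shows "lam + 2 * sqrt lam \<le> p * (lam - 1)" "1 + 2 / sqrt lam \<le> p"
proof -
  define s where "s = sqrt lam"
  have s: "s > 1" "lam = s\<^sup>2" using assms by (auto simp: s_def)
  have "(s + 2) / (lam - 1) \<le> (sqrt lambda0 + 2) / (lambda0 - 1)"
  proof -
    define r where "r = sqrt lambda0"
    have r: "r > 1" "lambda0 = r\<^sup>2" "r \<le> s" using assms by (auto simp: r_def s_def)
    have "(s + 2) * (r\<^sup>2 - 1) \<le> (r + 2) * (s\<^sup>2 - 1)"
    proof -
      have "(r + 2) * (s\<^sup>2 - 1) - (s + 2) * (r\<^sup>2 - 1) = (s - r) * (r * s + 1 + 2 * (r + s))"
        by (simp add: power2_eq_square algebra_simps)
      also have "\<dots> \<ge> 0" using r s by (intro mult_nonneg_nonneg) auto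
      finally show ?thesis by simp
    qed
    moreover have "0 < r\<^sup>2 - 1" "0 < s\<^sup>2 - 1" using r s by (auto simp: one_less_power)
    ultimately show ?thesis
      unfolding r_def[symmetric] r(2) s(2) using r(1) by (simp add: divide_le_eq pos_le_divide_eq mult.commute)
  qed
  moreover have "0 < lam - 1" using s assms by simp
  ultimately have "s + 2 \<le> (sqrt lambda0 + 2) / (lambda0 - 1) * (lam - 1)"
    by (simp add: pos_divide_le_eq)
  then have "2 * (lam - 1) + (s + 2) \<le> (2 + (sqrt lambda0 + 2) / (lambda0 - 1)) * (lam - 1)"
    by (simp add: distrib_right)
  then have "(2 * lam + s) / s \<le> (2 + (sqrt lambda0 + 2) / (lambda0 - 1)) * (lam - 1) / s"
    using s by (intro divide_right_mono) auto
  moreover have "(2 * lam + s) / s = 2 * s + 1"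
    using s by (simp add: field_simps power2_eq_square)
  ultimately show "lam + 2 * sqrt lam \<le> p * (lam - 1)"
    unfolding p_def s_def[symmetric] by (simp add: distrib_right)
  show "1 + 2 / sqrt lam \<le> p"
    unfolding p_def using assms by (simp add: add_divide_distrib)
qed

text \<open>\<open>lower_failure_base\<close> needs a base with logarithm at least
  \<open>5/2\<close>. The constant \<open>4 * exp (3/2)\<close> provides it, since e is below 4 and
  the other factors are at least 1.\<close>

lemma base_ge:
  fixes m X :: real
  assumes "1 \<le> m" "1 \<le> X"
  shows "exp (5/2) \<le> 4 * exp (3/2) * X powr (3/2) * m * sqrt (ln (exp 1 * m))"
proof -
  have "exp (5/2::real) = exp (3/2) * exp 1" by (simp flip: exp_add)
  also have "\<dots> \<le> exp (3/2) * 4" using exp_le by (intro mult_left_mono) auto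
  also have "\<dots> \<le> (4 * exp (3/2)) * (X powr (3/2) * m * sqrt (ln (exp 1 * m)))"
  proof -
    have "1 \<le> X powr (3/2)" using assms by (simp add: ge_one_powr_ge_zero)
    moreover have "1 \<le> sqrt (ln (exp 1 * m))" using assms by (simp add: ln_mult)
    ultimately have "1 * 1 * 1 \<le> X powr (3/2) * m * sqrt (ln (exp 1 * m))"
      using assms(1) by (intro mult_mono) auto
    then show ?thesis by simp
  qed
  finally show ?thesis by (simp add: mult_ac)
qed

text \<open>This is the failure bound per dimension. With \<open>l = ln B\<close>, the choice of
  \<open>p\<close> leaves an exponent of at most \<open>2 * s + 13/10 - 2 * s * l\<close>, and
  \<open>l \<ge> 5/2\<close> makes the last term outweigh the others.\<close>

lemma lower_failure_base:
  fixes lam B p :: real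
  assumes lam: "lam > 1" and B: "exp (5/2) \<le> B"
    and p: "lam + 2 * sqrt lam \<le> p * (lam - 1)"
  shows "(B * exp (2 / sqrt lam) / B powr p) powr lam * (3 * B powr p) \<le> exp (- sqrt lam)"
proof -
  define s where "s = sqrt lam"
  have s: "s > 1" "lam = s\<^sup>2" using lam by (auto simp: s_def)
  have Bpos: "B > 0" using B by (smt (verit) exp_gt_zero)
  define l where "l = ln B"
  have l: "l \<ge> 5/2" using B Bpos ln_ge_iff[of B "5/2"] by (simp add: l_def)
  have Bl: "B = exp l" using Bpos by (simp add: l_def)
  \<comment> \<open>\<open>13/10\<close> is a rational upper bound for \<open>ln 3\<close>.\<close>
  have "(3::real) \<le> exp (13/10)" using exp_lower_Taylor_quadratic[of "13/10::real"] by (simp add: power2_eq_square)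
  have "(B * exp (2 / s) / B powr p) powr lam = exp (lam * (l + 2 / s - p * l))"
    unfolding Bl by (simp add: powr_def exp_diff exp_add ln_div ln_mult)
  moreover have "3 * B powr p \<le> exp (13/10 + p * l)"
    using \<open>3 \<le> exp (13/10)\<close> unfolding Bl by (simp add: powr_def exp_add)
  ultimately have "(B * exp (2 / s) / B powr p) powr lam * (3 * B powr p)
      \<le> exp (lam * (l + 2 / s - p * l)) * exp (13/10 + p * l)"
    by (simp add: mult_left_mono)
  also have "\<dots> = exp (lam * (l + 2 / s - p * l) + (13/10 + p * l))" by (simp add: exp_add)
  also have "\<dots> \<le> exp (- s)"
  proof -
    have "lam * (2 / s) = 2 * s" using s by (simp add: power2_eq_square)
    then have "lam * (l + 2 / s - p * l) + (13/10 + p * l) = lam * l + 2 * s + 13/10 - p * (lam - 1) * l"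
      by (simp add: algebra_simps)
    also have "\<dots> \<le> lam * l + 2 * s + 13/10 - (lam + 2 * s) * l"
      using mult_right_mono[OF p[folded s_def], of l] l by simp
    also have "\<dots> = 2 * s + 13/10 - 2 * s * l" by (simp add: algebra_simps)
    \<comment> \<open>\<open>s > 1\<close> absorbs \<open>13/10\<close> into
      \<open>13/10 * s\<close>; the total becomes \<open>- 17/10 * s\<close>.\<close>
    also have "\<dots> \<le> 2 * s + 13/10 * s - 2 * s * (5/2)"
      using l s by (intro diff_mono add_mono mult_left_mono) auto
    also have "\<dots> \<le> - s" using s by simp
    finally show ?thesis by simp
  qed
  finally show ?thesis by (simp add: s_def)
qed

section \<open>Norms and singular values over all group translates\<close>

text \<open>These facts let the net lemmas apply to the norm of the image of \<open>x\<close> under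
  the matrix with rows \<open>a i\<close>, \<open>i \<in> I\<close>.\<close>

lemma L2_set_inner_seminorm:
  fixes a :: "'i \<Rightarrow> 'a::real_inner"
  shows L2_set_inner_triangle: "L2_set (\<lambda>i. a i \<bullet> (x + y)) I \<le> L2_set (\<lambda>i. a i \<bullet> x) I + L2_set (\<lambda>i. a i \<bullet> y) I"
    and L2_set_inner_scale: "L2_set (\<lambda>i. a i \<bullet> (c *\<^sub>R x)) I = \<bar>c\<bar> * L2_set (\<lambda>i. a i \<bullet> x) I"
    and L2_set_inner_continuous: "continuous_on UNIV (\<lambda>x. L2_set (\<lambda>i. a i \<bullet> x) I)"
proof -
  show "L2_set (\<lambda>i. a i \<bullet> (x + y)) I \<le> L2_set (\<lambda>i. a i \<bullet> x) I + L2_set (\<lambda>i. a i \<bullet> y) I"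
    unfolding inner_add_right by (rule L2_set_triangle_ineq)
  show "L2_set (\<lambda>i. a i \<bullet> (c *\<^sub>R x)) I = \<bar>c\<bar> * L2_set (\<lambda>i. a i \<bullet> x) I"
    by (simp add: L2_set_def power_mult_distrib sum_distrib_left[symmetric] real_sqrt_mult)
  show "continuous_on UNIV (\<lambda>x. L2_set (\<lambda>i. a i \<bullet> x) I)"
    unfolding L2_set_def by (intro continuous_intros)
qed

text \<open>The exponential of the sum is a product, and each factor is one of the positive terms of
  its orbit sum. The right-hand side is free of \<open>h\<close>, so \<open>h\<close> may depend on
  the Gaussian sample.\<close>

lemma exp_sum_squares_le_orbit_prod:
  fixes G :: "(real^'d^'d) set"
  assumes "finite G" "finite I" "\<And>i. i \<in> I \<Longrightarrow> h i \<in> G"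
  shows "exp (a * (L2_set (\<lambda>i. (h i *v z i) \<bullet> x) I)\<^sup>2) \<le> (\<Prod>i\<in>I. orbit_exp_sum G a x (z i))"
proof -
  have "exp (a * (L2_set (\<lambda>i. (h i *v z i) \<bullet> x) I)\<^sup>2) = (\<Prod>i\<in>I. exp (a * ((h i *v z i) \<bullet> x)\<^sup>2))"
    using assms(2) by (simp add: L2_set_def sum_nonneg sum_distrib_left exp_sum)
  also have "\<dots> \<le> (\<Prod>i\<in>I. orbit_exp_sum G a x (z i))"
    unfolding orbit_exp_sum_def
    using assms by (intro prod_mono conjI member_le_sum[where f = "\<lambda>g. exp (a * ((g *v z _) \<bullet> x)\<^sup>2)"]) auto
  finally show ?thesis .
qed

text \<open>For \<open>a = 3/8\<close> the Gaussian moment is 2, and \<open>8/3\<close> is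
  \<open>1 / a\<close>. A net of mesh \<open>1/6\<close> has at most \<open>13 ^ CARD('d)\<close>
  points and costs the factor \<open>6/5\<close>.\<close>

lemma gauss_upper_event:
  fixes G :: "(real^'d^'d) set" and n :: nat and q :: real
  assumes G: "finite_orth_group G"
  defines "M \<equiv> gauss_space n :: ((nat \<times> 'd) \<Rightarrow> real) measure"
  shows "\<exists>U\<in>sets M. measure M U \<le> exp (- q) \<and>
    (\<forall>\<omega>\<in>space M - U. \<forall>h x. (\<forall>i<n. h i \<in> G) \<longrightarrow>
      L2_set (\<lambda>i. (h i *v gauss_vecs \<omega> i) \<bullet> x) {..<n}
        \<le> 6/5 * sqrt (8/3 * (real n * ln (exp 1 * real (card G)) + 3 * real CARD('d) + q)) * norm x)"
proof -
  interpret prob_space M unfolding M_def by (rule prob_space_gauss_space)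
  note finG = finite_group[OF G]
  note m = card_group_ge_1[OF G]
  \<comment> \<open>The three summands pay for the expected product, for the size of the net and for
    the desired failure probability.\<close>
  define v where "v = real n * ln (exp 1 * real (card G)) + 3 * real CARD('d) + q"
  obtain N :: "(real^'d) set" where N: "finite N" "N \<subseteq> sphere 0 1"
      "real (card N) \<le> (1 + 2 / (1/6)) ^ DIM(real^'d)"
      "\<forall>x. norm x = 1 \<longrightarrow> (\<exists>y\<in>N. norm (x - y) \<le> 1/6)"
    using sphere_net_exists[of "1/6", where 'a = "real^'d", OF divide_pos_pos[OF zero_less_one zero_less_numeral]]
    by (elim exE conjE)
  define T where "T x = {\<omega> \<in> space M. exp v \<le> (\<Prod>i\<in>{..<n}. orbit_exp_sum G (3/8) x (gauss_vecs \<omega> i))}" for x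
  have T: "T x \<in> sets M" "measure M (T x) \<le> exp (- v) * (2 * real (card G)) ^ n" if "x \<in> N" for x
  proof -
    have "norm x = 1" using that N(2) by auto
    have sq: "real (card G) / sqrt (1 - 2 * (3/8)) = 2 * real (card G)" by (simp add: real_sqrt_divide)
    have "(3/8::real) < 1/2" by simp
    note tail = gauss_orbit_tail[OF G subset_refl[of "{..<n}"] \<open>norm x = 1\<close> this, of v, unfolded sq]
    show "T x \<in> sets M" using tail(1) by (simp only: T_def M_def)
    show "measure M (T x) \<le> exp (- v) * (2 * real (card G)) ^ n"
      using tail(2) by (simp only: T_def M_def card_lessThan)
  qed
  define U where "U = (\<Union>x\<in>N. T x)"
  have "measure M U \<le> (\<Sum>x\<in>N. measure M (T x))"
    unfolding U_def using T by (intro finite_measure_subadditive_finite N) auto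
  also have "\<dots> \<le> real (card N) * (exp (- v) * (2 * real (card G)) ^ n)"
    using T by (intro sum_bounded_above) auto
  also have "\<dots> \<le> exp (3 * real CARD('d)) * (exp (- v) * exp (real n * ln (exp 1 * real (card G))))"
  proof (intro mult_mono order_refl)
    \<comment> \<open>The bound \<open>13 \<le> exp 3\<close> for the net follows from e being at
      least \<open>5/2\<close>.\<close>
    have "(1 + 1 + 1\<^sup>2 / 2)^3 \<le> exp (1::real) ^ 3"
      by (intro power_mono exp_lower_Taylor_quadratic) auto
    moreover have "exp (1::real) ^ 3 = exp 3" using exp_of_nat_mult[of 3 "1::real"] by simp
    ultimately have "(13::real) \<le> exp 3" by (simp add: power3_eq_cube)
    then have "(13::real) ^ CARD('d) \<le> exp 3 ^ CARD('d)" by (rule power_mono) simp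
    also have "\<dots> = exp (3 * real CARD('d))" by (simp add: exp_of_nat_mult[symmetric] mult.commute)
    finally have "(1 + 2 / (1/6)) ^ DIM(real^'d) \<le> exp (3 * real CARD('d))" by simp
    with N(3) show "real (card N) \<le> exp (3 * real CARD('d))" by (rule order_trans)
    have "2 * real (card G) \<le> exp 1 * real (card G)"
      using exp_ge_add_one_self[of 1] by (intro mult_right_mono) auto
    then have "(2 * real (card G)) ^ n \<le> (exp 1 * real (card G)) ^ n" by (rule power_mono) simp
    also have "\<dots> = exp (real n * ln (exp 1 * real (card G)))"
      using m by (simp add: exp_of_nat_mult)
    finally show "(2 * real (card G)) ^ n \<le> exp (real n * ln (exp 1 * real (card G)))" .
  qed auto
  also have "\<dots> = exp (- q)" by (simp add: v_def exp_add[symmetric])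
  finally have U: "measure M U \<le> exp (- q)" .
  show ?thesis
  proof (intro bexI[of _ U] conjI ballI allI impI U)
    show "U \<in> sets M" unfolding U_def using T N by (intro sets.finite_UN) auto
    fix \<omega> x and h :: "nat \<Rightarrow> real^'d^'d"
    assume \<omega>: "\<omega> \<in> space M - U" and h: "\<forall>i<n. h i \<in> G"
    let ?\<nu> = "\<lambda>x. L2_set (\<lambda>i. (h i *v gauss_vecs \<omega> i) \<bullet> x) {..<n}"
    have "?\<nu> y \<le> sqrt (8/3 * v)" if "y \<in> N" for y
    proof -
      have "exp (3/8 * (?\<nu> y)\<^sup>2) \<le> (\<Prod>i\<in>{..<n}. orbit_exp_sum G (3/8) y (gauss_vecs \<omega> i))"
        using h finG by (intro exp_sum_squares_le_orbit_prod) auto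
      also have "\<dots> < exp v" using \<omega> that by (auto simp: U_def T_def)
      finally show ?thesis by (intro real_le_rsqrt) simp
    qed
    from seminorm_le_of_net[of ?\<nu> N "1/6", OF L2_set_inner_triangle L2_set_inner_scale
        L2_set_inner_continuous N(4)[rule_format] _ this]
    have "?\<nu> x \<le> sqrt (8/3 * v) / (1 - 1/6) * norm x" by simp
    then show "?\<nu> x \<le> 6/5 * sqrt (8/3 * (real n * ln (exp 1 * real (card G)) + 3 * real CARD('d) + q)) * norm x"
      by (simp add: v_def)
  qed
qed

text \<open>A negative exponent turns small norms into large exponentials. The union runs over the
  \<open>k\<close>-subsets and the net only; \<open>b\<close> and \<open>t\<close> are quantified
  after the event because, off \<open>W\<close>, the step from the net to the sphere is
  deterministic.\<close>

lemma gauss_lower_event: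
  fixes G :: "(real^'d^'d) set" and n k :: nat and e s :: real
  assumes G: "finite_orth_group G" and k: "0 < k" and e: "0 < e" and s: "0 < s" "s\<^sup>2 \<le> real k"
  defines "M \<equiv> gauss_space n :: ((nat \<times> 'd) \<Rightarrow> real) measure"
  shows "\<exists>W\<in>sets M. measure M W \<le> real (n choose k) * (1 + 2 / e) ^ CARD('d)
        * (real (card G) * (s / sqrt (real k)) * exp (1/2)) ^ k \<and>
    (\<forall>\<omega>\<in>space M - W. \<forall>I h b t x. I \<subseteq> {..<n} \<and> card I = k \<and> (\<forall>i\<in>I. h i \<in> G) \<and>
      0 \<le> b \<and> (\<forall>x. L2_set (\<lambda>i. (h i *v gauss_vecs \<omega> i) \<bullet> x) I \<le> b * norm x) \<and> t + e * b \<le> s \<longrightarrow>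
      t * norm x \<le> L2_set (\<lambda>i. (h i *v gauss_vecs \<omega> i) \<bullet> x) I)"
proof -
  interpret prob_space M unfolding M_def by (rule prob_space_gauss_space)
  note finG = finite_group[OF G]
  \<comment> \<open>This \<open>\<tau>\<close> minimizes the Chernoff bound
    \<open>exp (\<tau> * s\<^sup>2) * (1 + 2 * \<tau>) powr (- k / 2)\<close>. It makes the Gaussian
    moment equal to \<open>s / sqrt k\<close>.\<close>
  define \<tau> where "\<tau> = (real k / s\<^sup>2 - 1) / 2"
  have \<tau>: "0 \<le> \<tau>" using s by (simp add: \<tau>_def pos_le_divide_eq)
  have \<tau>2: "1 - 2 * (- \<tau>) = real k / s\<^sup>2" by (simp add: \<tau>_def add_divide_distrib diff_divide_distrib)
  define v where "v = - \<tau> * s\<^sup>2"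
  \<comment> \<open>Here \<open>- v = (k - s\<^sup>2) / 2\<close>, which yields the factor
    \<open>exp (1/2)\<close> per row.\<close>
  have v: "- v \<le> real k / 2" using s by (simp add: v_def \<tau>_def field_simps)
  obtain N :: "(real^'d) set" where N: "finite N" "N \<subseteq> sphere 0 1"
      "real (card N) \<le> (1 + 2 / e) ^ DIM(real^'d)"
      "\<forall>x. norm x = 1 \<longrightarrow> (\<exists>y\<in>N. norm (x - y) \<le> e)"
    using sphere_net_exists[OF e, where 'a = "real^'d"] by (elim exE conjE)
  define J where "J = {I. I \<subseteq> {..<n} \<and> card I = k} \<times> N"
  define T where "T p = {\<omega> \<in> space M. exp v \<le> (\<Prod>i\<in>fst p. orbit_exp_sum G (- \<tau>) (snd p) (gauss_vecs \<omega> i))}" for p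
  define c where "c = (real (card G) * (s / sqrt (real k)) * exp (1/2)) ^ k"
  have c: "0 \<le> c" using s by (simp add: c_def)
  have T: "T p \<in> sets M" "measure M (T p) \<le> c" if "p \<in> J" for p
  proof -
    obtain I x where Ix: "p = (I, x)" by (cases p)
    have p: "p = (I, x)" "I \<subseteq> {..<n}" "card I = k" "norm x = 1"
      using that N(2) by (auto simp: Ix J_def)
    have "- \<tau> < 1/2" using \<tau> by simp
    note tail = gauss_orbit_tail[OF G p(2,4) this, of v]
    show "T p \<in> sets M" using tail(1) by (simp add: T_def M_def p(1))
    have "measure M (T p) \<le> exp (- v) * (real (card G) / sqrt (1 - 2 * (- \<tau>))) ^ k"
      using tail(2) by (simp add: T_def M_def p(1,3))
    also have "\<dots> \<le> exp (real k / 2) * (real (card G) / sqrt (1 - 2 * (- \<tau>))) ^ k"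
      using v \<tau> by (intro mult_right_mono) auto
    also have "exp (real k / 2) = exp (1/2) ^ k" by (simp add: exp_of_nat_mult[symmetric])
    also have "exp (1/2) ^ k * (real (card G) / sqrt (1 - 2 * (- \<tau>))) ^ k = c"
      unfolding \<tau>2 c_def using s by (simp add: power_mult_distrib[symmetric] real_sqrt_divide mult_ac)
    finally show "measure M (T p) \<le> c" .
  qed
  have finJ: "finite J" using N(1) by (simp add: J_def)
  define W where "W = (\<Union>p\<in>J. T p)"
  have "measure M W \<le> (\<Sum>p\<in>J. measure M (T p))"
    unfolding W_def using T finJ by (intro finite_measure_subadditive_finite) auto
  also have "\<dots> \<le> real (card J) * c"
    using T by (intro sum_bounded_above) auto
  also have "\<dots> = real (n choose k) * real (card N) * c"
    by (simp add: J_def card_cartesian_product n_subsets)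
  also have "\<dots> \<le> real (n choose k) * (1 + 2 / e) ^ CARD('d) * c"
    using N(3) c by (intro mult_right_mono mult_left_mono) auto
  finally have W: "measure M W \<le> real (n choose k) * (1 + 2 / e) ^ CARD('d) * c" .
  show ?thesis
  proof (intro bexI[of _ W] conjI ballI allI impI W[unfolded c_def])
    show "W \<in> sets M" unfolding W_def using T finJ by (intro sets.finite_UN) auto
    fix \<omega> I x b t and h :: "nat \<Rightarrow> real^'d^'d"
    let ?\<nu> = "\<lambda>x. L2_set (\<lambda>i. (h i *v gauss_vecs \<omega> i) \<bullet> x) I"
    assume \<omega>: "\<omega> \<in> space M - W"
      and "I \<subseteq> {..<n} \<and> card I = k \<and> (\<forall>i\<in>I. h i \<in> G) \<and>
        0 \<le> b \<and> (\<forall>x. ?\<nu> x \<le> b * norm x) \<and> t + e * b \<le> s"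
    then have I: "I \<subseteq> {..<n}" "card I = k" and h: "\<And>i. i \<in> I \<Longrightarrow> h i \<in> G"
      and b: "0 \<le> b" "\<And>x. ?\<nu> x \<le> b * norm x" and t: "t + e * b \<le> s"
      by auto
    have "s \<le> ?\<nu> y" if y: "y \<in> N" for y
    proof -
      have "exp (- \<tau> * (?\<nu> y)\<^sup>2) \<le> (\<Prod>i\<in>I. orbit_exp_sum G (- \<tau>) y (gauss_vecs \<omega> i))"
        using h finG finite_subset[OF I(1)] by (intro exp_sum_squares_le_orbit_prod) auto
      also have "\<dots> < exp v"
      proof -
        have "(I, y) \<in> J" using y I by (simp add: J_def)
        then have "\<omega> \<notin> T (I, y)" using \<omega> by (auto simp: W_def)
        then show ?thesis using \<omega> by (simp add: T_def not_le)
      qed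
      finally have "\<tau> * s\<^sup>2 < \<tau> * (?\<nu> y)\<^sup>2" by (simp add: v_def)
      \<comment> \<open>Strictness of the previous inequality excludes \<open>\<tau> = 0\<close>, so
        the factor may be cancelled.\<close>
      then have "s\<^sup>2 < (?\<nu> y)\<^sup>2" using \<tau> by (simp add: mult_less_cancel_left)
      then show ?thesis by (rule less_imp_le[OF power_less_imp_less_base]) simp
    qed
    with t have "t + e * b \<le> ?\<nu> y" if "y \<in> N" for y using that by force
    from seminorm_ge_of_net[of ?\<nu> N e, OF L2_set_inner_triangle L2_set_inner_scale N(4)[rule_format] b this]
    show "t * norm x \<le> ?\<nu> x" .
  qed
qed

text \<open>\<open>D * sqrt lam \<le> n / sqrt lam\<close> makes the terms beyond
  \<open>n * L\<close> at most \<open>4 * n * L / sqrt lam\<close>. Then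
  \<open>1 + u \<le> exp u\<close> applies, and \<open>36/25 * (8/3) \<le> 4\<close> gives the
  leading constant 2.\<close>

lemma upper_constant_le:
  fixes lam L n D :: real
  assumes lam: "lam > 1" and L: "1 \<le> L" and n: "0 \<le> n" and D: "0 \<le> D" "D * lam \<le> n"
  shows "6/5 * sqrt (8/3 * (n * L + 3 * D + D * sqrt lam)) \<le> 2 * sqrt (n * L) * exp (2 / sqrt lam)"
proof -
  define s where "s = sqrt lam"
  have s: "s > 1" "lam = s\<^sup>2" using lam by (auto simp: s_def)
  have "D * s * s \<le> n" using D(2) by (simp add: s(2) power2_eq_square mult.assoc)
  then have Ds: "D * s \<le> n / s" using s by (simp add: pos_le_divide_eq)
  moreover have "D \<le> D * s" using D(1) s by (simp add: mult_le_cancel_left1)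
  ultimately have "3 * D + D * s \<le> 4 * (n / s)" by linarith
  also have "\<dots> \<le> 4 * (n * L / s)" using n L s by (intro mult_left_mono divide_right_mono) (auto simp: mult_le_cancel_left1)
  finally have "n * L + 3 * D + D * s \<le> n * L * (1 + 4 / s)" by (simp add: distrib_left mult_ac)
  also have "\<dots> \<le> n * L * exp (4 / s)"
    using n L exp_ge_add_one_self[of "4 / s"] by (intro mult_left_mono) auto
  finally have le: "n * L + 3 * D + D * s \<le> n * L * exp (4 / s)" .
  have "6/5 * sqrt (8/3 * (n * L + 3 * D + D * s)) = sqrt ((36/25) * (8/3) * (n * L + 3 * D + D * s))"
    unfolding real_sqrt_mult[of "36/25 * (8/3)"] real_sqrt_mult[of "8/3"] real_sqrt_mult[of "36/25"]
    by (simp add: real_sqrt_divide)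
  also have "\<dots> \<le> sqrt (4 * (n * L) * exp (4 / s))"
  proof (rule real_sqrt_le_mono)
    have "36/25 * (8/3) * (n * L + 3 * D + D * s) \<le> 36/25 * (8/3) * (n * L * exp (4 / s))"
      by (rule mult_left_mono[OF le]) simp
    also have "\<dots> \<le> 4 * (n * L * exp (4 / s))"
      using n L by (intro mult_right_mono) auto
    finally show "36/25 * (8/3) * (n * L + 3 * D + D * s) \<le> 4 * (n * L) * exp (4 / s)"
      by (simp only: mult.assoc)
  qed
  also have "\<dots> = 2 * sqrt (n * L) * exp (2 / s)"
  proof -
    have "exp (4 / s) = (exp (2 / s))\<^sup>2" by (simp flip: exp_of_nat_mult add: exp_double[symmetric])
    then show ?thesis by (simp add: real_sqrt_mult)
  qed
  finally show ?thesis by (simp add: s_def)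
qed

text \<open>The ratio \<open>n / k \<le> X\<close> turns the upper constant, normalized by
  \<open>sqrt k\<close>, into a factor \<open>sqrt X\<close>. The outer 2 comes from the level
  \<open>2 * t\<close> required on the net.\<close>

lemma lower_scale_le:
  fixes n k X L R r :: real
  assumes k: "0 < k" "n \<le> k * X" and n: "0 \<le> n" and X: "0 \<le> X" and L: "0 \<le> L" and R: "0 < R" and r: "0 \<le> r"
  shows "2 * (2 * sqrt (n * L) * r / R) / sqrt k \<le> 4 * sqrt X * sqrt L * r / R"
proof -
  have "sqrt (n * L) / sqrt k = sqrt (n / k) * sqrt L"
    by (simp add: real_sqrt_mult real_sqrt_divide)
  also have "\<dots> \<le> sqrt X * sqrt L"
    using k L by (intro mult_right_mono real_sqrt_le_mono) (auto simp: pos_divide_le_eq mult.commute)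
  finally have "sqrt (n * L) / sqrt k * (4 * r / R) \<le> sqrt X * sqrt L * (4 * r / R)"
    using r R by (intro mult_right_mono) auto
  then show ?thesis by (simp add: mult_ac)
qed

text \<open>Per row, the binomial coefficient contributes \<open>exp 1 * X\<close>, and the Chernoff
  factor contributes \<open>sqrt X\<close> and \<open>exp (1/2)\<close>. This is the source of both
  exponents \<open>3/2\<close> in \<open>B\<close>.\<close>

lemma lower_failure_le:
  fixes n k D :: nat and m X L lam B R s :: real
  assumes k: "0 < k" "real n \<le> real k * X" "lam * real D \<le> real k"
    and m: "1 \<le> m" and X: "1 \<le> X" and s: "0 \<le> s" "s / sqrt (real k) \<le> 4 * sqrt X * sqrt L * exp (2 / sqrt lam) / R"
    and B: "B = 4 * exp (3/2) * X powr (3/2) * m * sqrt L"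
    and R: "1 \<le> R" "B * exp (2 / sqrt lam) \<le> R" "0 < B"
    and base: "(B * exp (2 / sqrt lam) / R) powr lam * (3 * R) \<le> exp (- sqrt lam)"
  shows "real (n choose k) * (1 + 2 / (1 / R)) ^ D * (m * (s / sqrt (real k)) * exp (1/2)) ^ k
    \<le> exp (- (real D * sqrt lam))"
proof -
  define \<rho> where "\<rho> = B * exp (2 / sqrt lam) / R"
  have \<rho>: "0 < \<rho>" "\<rho> \<le> 1" using R by (auto simp: \<rho>_def)
  have "real (n choose k) \<le> (exp 1 * real n / real k) ^ k" by (rule binomial_le_exp_power[OF k(1)])
  also have "\<dots> \<le> (exp 1 * X) ^ k"
    using k by (intro power_mono) (auto simp: pos_divide_le_eq mult_ac)
  finally have bin: "real (n choose k) \<le> (exp 1 * X) ^ k" .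
  have "exp 1 * X * (m * (s / sqrt (real k)) * exp (1/2))
    \<le> exp 1 * X * (m * (4 * sqrt X * sqrt L * exp (2 / sqrt lam) / R) * exp (1/2))"
    using m X s by (intro mult_left_mono mult_right_mono) auto
  also have "\<dots> = \<rho>"
  proof -
    have "exp (3/2::real) = exp 1 * exp (1/2)" by (simp flip: exp_add)
    moreover have "X powr (3/2) = X * sqrt X"
    proof -
      have "X powr (3/2) = X powr (1 + 1/2)" by simp
      also have "\<dots> = X * sqrt X" using X by (subst powr_add) (simp add: powr_half_sqrt)
      finally show ?thesis .
    qed
    ultimately show ?thesis by (simp add: \<rho>_def B mult_ac)
  qed
  finally have le\<rho>: "exp 1 * X * (m * (s / sqrt (real k)) * exp (1/2)) \<le> \<rho>" .
  have "real (n choose k) * (1 + 2 / (1 / R)) ^ D * (m * (s / sqrt (real k)) * exp (1/2)) ^ k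
    \<le> (exp 1 * X) ^ k * (3 * R) ^ D * (m * (s / sqrt (real k)) * exp (1/2)) ^ k"
    using bin R m s by (intro mult_right_mono mult_mono power_mono) auto
  also have "\<dots> = (exp 1 * X * (m * (s / sqrt (real k)) * exp (1/2))) ^ k * (3 * R) ^ D"
    unfolding power_mult_distrib[of "exp 1 * X"] by (simp only: mult_ac)
  also have "\<dots> \<le> \<rho> ^ k * (3 * R) ^ D"
    using le\<rho> R m s X by (intro mult_right_mono power_mono) auto
  \<comment> \<open>Since \<open>\<rho> \<le> 1\<close>, the exponent \<open>k\<close> may be
    lowered to \<open>lam * D\<close>, which collects everything into one \<open>D\<close>-th
    power.\<close>
  also have "\<dots> \<le> (\<rho> powr lam) ^ D * (3 * R) ^ D"
  proof (intro mult_right_mono)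
    have "\<rho> ^ k = \<rho> powr real k" using \<rho> by (simp add: powr_realpow)
    also have "\<dots> \<le> \<rho> powr (lam * real D)" using \<rho> k by (intro powr_mono') auto
    also have "\<dots> = (\<rho> powr lam) ^ D" using \<rho> by (simp add: powr_powr[symmetric] powr_realpow)
    finally show "\<rho> ^ k \<le> (\<rho> powr lam) ^ D" .
  qed (use R in auto)
  also have "\<dots> = (\<rho> powr lam * (3 * R)) ^ D" by (simp only: power_mult_distrib)
  also have "\<dots> \<le> exp (- sqrt lam) ^ D"
    using base R by (intro power_mono) (auto simp: \<rho>_def)
  also have "\<dots> = exp (- (real D * sqrt lam))" by (simp flip: exp_of_nat_mult)
  finally show ?thesis .
qed

section \<open>Choice of parameters and conclusion\<close>

theorem theorem32:
  fixes G :: "(real^'d^'d) set" and n :: nat and lambda0 :: real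
  assumes "finite_orth_group G"
    and "real n / (real (chi G) * real CARD('d)) \<ge> lambda0"
    and "lambda0 > 1"
  shows "let m = card G; chiG = chi G; d = CARD('d);
             lam = real n / (real chiG * real d);
             C = 4 * exp (3/2); c = 2 + (sqrt lambda0 + 2) / (lambda0 - 1);
             M = gauss_space n :: ((nat \<times> 'd) \<Rightarrow> real) measure
         in \<exists>A\<in>sets M.
              A \<subseteq> {\<omega>\<in>space M. distortion G n (max_filter_bank G n (gauss_vecs \<omega>))
                     \<le> ereal ((C * real chiG powr (3/2) * real m * sqrt (ln (exp 1 * real m)))
                               powr (1 + c / sqrt lam))}
            \<and> measure M A \<ge> 1 - 3 * exp (- real d * sqrt lam)"
proof -
  note G = assms(1)
  define D where "D = CARD('d)"
  define X where "X = real (chi G)"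
  define m where "m = real (card G)"
  define L where "L = ln (exp 1 * m)"
  define lam where "lam = real n / (X * real D)"
  define M where "M = (gauss_space n :: ((nat \<times> 'd) \<Rightarrow> real) measure)"
  define p where "p = 1 + (2 + (sqrt lambda0 + 2) / (lambda0 - 1)) / sqrt lam"
  define B where "B = 4 * exp (3/2) * X powr (3/2) * m * sqrt L"
  define R where "R = B powr p"
  interpret prob_space M unfolding M_def by (rule prob_space_gauss_space)
  have D: "1 \<le> real D" by (simp add: D_def Suc_le_eq)
  have lam0: "lambda0 \<le> lam" using assms(2) by (simp add: lam_def X_def D_def)
  then have lam: "1 < lam" using assms(3) by simp
  have X: "1 \<le> X"
  proof -
    \<comment> \<open>Division by zero yields 0, so \<open>chi G = 0\<close> would give
      \<open>lam = 0\<close>.\<close>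
    have "chi G \<noteq> 0"
    proof
      assume "chi G = 0"
      then have "lam = 0" by (simp add: lam_def X_def)
      with lam show False by simp
    qed
    then show ?thesis by (simp add: X_def)
  qed
  have nlam: "real n = lam * real D * X" using X D by (simp add: lam_def)
  have npos: "0 < real n" unfolding nlam using X D lam by simp
  have Dn: "real D * lam \<le> real n"
    unfolding nlam using X D lam by (simp add: mult.commute mult_le_cancel_left1)
  have m: "1 \<le> m" using card_group_ge_1[OF G] by (simp add: m_def)
  have L: "1 \<le> L" using m by (simp add: L_def ln_mult)
  have Bge: "exp (5/2) \<le> B" unfolding B_def L_def by (rule base_ge[OF m X])
  then have B1: "1 < B" using exp_ge_add_one_self[of "5/2::real"] by linarith
  note p = exponent_bound[OF assms(3) lam0, folded p_def]
  \<comment> \<open>As \<open>B\<close> is at least e, a power of \<open>B\<close> absorbs the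
    exponential, and \<open>p\<close> leaves room for the extra exponent
    \<open>2 / sqrt lam\<close>.\<close>
  have R2: "B * exp (2 / sqrt lam) \<le> R"
  proof -
    have "exp 1 \<le> exp (5/2::real)" by simp
    then have "exp 1 \<le> B" using Bge by linarith
    then have "exp 1 powr (2 / sqrt lam) \<le> B powr (2 / sqrt lam)"
      using lam by (intro powr_mono2) auto
    then have "B * exp (2 / sqrt lam) \<le> B * B powr (2 / sqrt lam)"
      using B1 by (simp add: powr_def)
    also have "\<dots> = B powr (1 + 2 / sqrt lam)" using B1 by (simp add: powr_add)
    also have "\<dots> \<le> R" unfolding R_def using B1 p(2) by (intro powr_mono) auto
    finally show ?thesis .
  qed
  have "B * 1 \<le> B * exp (2 / sqrt lam)" using B1 lam by (intro mult_left_mono) auto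
  with R2 B1 have R1: "1 \<le> R" by linarith
  define b where "b = 2 * sqrt (real n * L) * exp (2 / sqrt lam)"
  have b: "0 < b" using npos L by (simp add: b_def)
  \<comment> \<open>With this \<open>t\<close> the quotient \<open>b / t\<close> is exactly the
    claimed bound \<open>R\<close>.\<close>
  define t where "t = b / R"
  have t: "0 < t" using b R1 by (simp add: t_def)
  \<comment> \<open>The pigeonhole argument guarantees \<open>n / chi G = lam * D\<close> rows,
    rounded up.\<close>
  define k where "k = nat \<lceil>lam * real D\<rceil>"
  have lamD: "0 < lam * real D" using lam D by simp
  have kge: "lam * real D \<le> real k" unfolding k_def by (rule real_nat_ceiling_ge)
  then have "0 < real k" using lamD by linarith
  then have k0: "0 < k" by simp
  have nk: "real n \<le> real k * X" unfolding nlam using kge X by (intro mult_right_mono) auto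
  have kmin: "k \<le> j" if "n \<le> j * chi G" for j
  proof -
    have "lam * real D * X \<le> real j * X"
      using of_nat_mono[OF that, where 'a = real] nlam by (simp add: X_def)
    then have "lam * real D \<le> real j" using X by simp
    then show ?thesis unfolding k_def by (simp add: ceiling_le_iff nat_le_iff)
  qed
  have sk: "2 * t / sqrt (real k) \<le> 4 * sqrt X * sqrt L * exp (2 / sqrt lam) / R"
    unfolding t_def b_def using k0 nk npos X L R1 by (intro lower_scale_le) auto
  \<comment> \<open>This condition keeps the Chernoff parameter of \<open>gauss_lower_event\<close>
    nonnegative.\<close>
  have sk2: "(2 * t)\<^sup>2 \<le> real k"
  proof -
    have "4 * sqrt X * sqrt L \<le> B"
    proof -
      have "sqrt X = X powr (1/2)" using X by (simp add: powr_half_sqrt)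
      also have "\<dots> \<le> X powr (3/2)" using X by (intro powr_mono) auto
      finally have "4 * 1 * sqrt X * 1 * sqrt L \<le> B"
        unfolding B_def using X m L by (intro mult_mono) auto
      then show ?thesis by simp
    qed
    then have "4 * sqrt X * sqrt L * exp (2 / sqrt lam) \<le> R"
      using R2 by (meson exp_ge_zero mult_right_mono order_trans)
    then have "2 * t / sqrt (real k) \<le> 1" using sk R1 by (intro order_trans[OF sk]) simp
    then have "2 * t \<le> sqrt (real k)" using k0 by simp
    then have "(2 * t)\<^sup>2 \<le> (sqrt (real k))\<^sup>2" using t by (intro power_mono) auto
    then show ?thesis by simp
  qed
  obtain U where U: "U \<in> sets M" "measure M U \<le> exp (- (real D * sqrt lam))"
    and Ub: "\<forall>\<omega>\<in>space M - U. \<forall>h x. (\<forall>i<n. h i \<in> G) \<longrightarrow>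
      L2_set (\<lambda>i. (h i *v gauss_vecs \<omega> i) \<bullet> x) {..<n}
        \<le> 6/5 * sqrt (8/3 * (real n * L + 3 * real D + real D * sqrt lam)) * norm x"
    using gauss_upper_event[OF G, of n "real D * sqrt lam", folded M_def m_def D_def, folded L_def]
    by (elim bexE conjE)
  have Ub': "L2_set (\<lambda>i. (h i *v gauss_vecs \<omega> i) \<bullet> x) {..<n} \<le> b * norm x"
    if "\<omega> \<in> space M - U" "\<And>i. i < n \<Longrightarrow> h i \<in> G" for \<omega> h x
  proof -
    have "6/5 * sqrt (8/3 * (real n * L + 3 * real D + real D * sqrt lam)) \<le> b"
      unfolding b_def using lam L npos D Dn by (intro upper_constant_le) auto
    then show ?thesis using Ub that by (meson mult_right_mono norm_ge_zero order_trans)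
  qed
  \<comment> \<open>The mesh \<open>1 / R\<close> makes the net error \<open>b / R\<close> equal to
    \<open>t\<close>, so the level \<open>2 * t\<close> on the net leaves \<open>t\<close> on the
    whole sphere.\<close>
  have pos: "0 < 1 / R" "0 < 2 * t" using R1 t by auto
  obtain W where W: "W \<in> sets M"
      "measure M W \<le> real (n choose k) * (1 + 2 / (1 / R)) ^ D
         * (m * (2 * t / sqrt (real k)) * exp (1/2)) ^ k"
    and Wb: "\<forall>\<omega>\<in>space M - W. \<forall>I h b t' x. I \<subseteq> {..<n} \<and> card I = k \<and> (\<forall>i\<in>I. h i \<in> G) \<and>
      0 \<le> b \<and> (\<forall>x. L2_set (\<lambda>i. (h i *v gauss_vecs \<omega> i) \<bullet> x) I \<le> b * norm x) \<and> t' + 1 / R * b \<le> 2 * t \<longrightarrow>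
      t' * norm x \<le> L2_set (\<lambda>i. (h i *v gauss_vecs \<omega> i) \<bullet> x) I"
    using gauss_lower_event[OF G k0 pos sk2, of n, folded M_def m_def D_def]
    by (elim bexE conjE)
  have Wm: "measure M W \<le> exp (- (real D * sqrt lam))"
  proof (rule order_trans[OF W(2) lower_failure_le[OF k0 nk kge m X _ sk B_def R1 R2]])
    show "(B * exp (2 / sqrt lam) / R) powr lam * (3 * R) \<le> exp (- sqrt lam)"
      unfolding R_def by (rule lower_failure_base[OF lam Bge p(1)])
  qed (use t B1 in auto)
  define A where "A = space M - (U \<union> W)"
  have "A \<in> sets M" using U(1) W(1) by (auto simp: A_def)
  moreover have "distortion G n (max_filter_bank G n (gauss_vecs \<omega>)) \<le> ereal R" if \<omega>: "\<omega> \<in> A" for \<omega>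
  proof -
    have \<omega>': "\<omega> \<in> space M - U" "\<omega> \<in> space M - W" using \<omega> by (auto simp: A_def)
    have low: "t * norm x \<le> L2_set (\<lambda>i. (h i *v gauss_vecs \<omega> i) \<bullet> x) I"
      if I: "I \<subseteq> {..<n}" "card I = k" and h: "\<And>i. i \<in> I \<Longrightarrow> h i \<in> G" for I h x
    proof -
      have "L2_set (\<lambda>i. (h i *v gauss_vecs \<omega> i) \<bullet> x) I \<le> b * norm x" for x
      proof -
        \<comment> \<open>The identity fills the rows outside \<open>I\<close>, so that the bound
          for all \<open>n\<close> rows applies to the submatrix.\<close>
        define h' where "h' i = (if i \<in> I then h i else mat 1)" for i
        have "L2_set (\<lambda>i. (h i *v gauss_vecs \<omega> i) \<bullet> x) I = L2_set (\<lambda>i. (h' i *v gauss_vecs \<omega> i) \<bullet> x) I"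
          by (intro L2_set_cong) (auto simp: h'_def)
        also have "\<dots> \<le> L2_set (\<lambda>i. (h' i *v gauss_vecs \<omega> i) \<bullet> x) {..<n}"
          unfolding L2_set_def using I by (intro real_sqrt_le_mono sum_mono2) auto
        also have "\<dots> \<le> b * norm x"
          using h one_mem[OF G] by (intro Ub'[OF \<omega>'(1)]) (auto simp: h'_def)
        finally show ?thesis .
      qed
      moreover have "t + 1 / R * b \<le> 2 * t" by (simp add: t_def)
      ultimately show ?thesis
        using I h b by (intro Wb[rule_format, OF \<omega>'(2), of I h b t x] conjI) auto
    qed
    have "distortion G n (max_filter_bank G n (gauss_vecs \<omega>)) \<le> ereal (b / t)"
    proof (rule distortion_le[OF G t])
      show "t * orbit_dist G x y \<le> dist_n n (max_filter_bank G n (gauss_vecs \<omega>) x) (max_filter_bank G n (gauss_vecs \<omega>) y)" for x y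
        using t by (intro max_filter_bank_lower[OF G _ kmin low]) auto
      show "dist_n n (max_filter_bank G n (gauss_vecs \<omega>) x) (max_filter_bank G n (gauss_vecs \<omega>) y) \<le> b * orbit_dist G x y" for x y
        by (intro max_filter_bank_upper[OF G] Ub'[OF \<omega>'(1)])
    qed (use b in auto)
    also have "b / t = R" using b R1 by (simp add: t_def)
    finally show ?thesis .
  qed
  moreover have "1 - 3 * exp (- (real D * sqrt lam)) \<le> measure M A"
  proof -
    have "measure M (U \<union> W) \<le> measure M U + measure M W"
      using U(1) W(1) by (rule measure_Un_le)
    also have "\<dots> \<le> 3 * exp (- (real D * sqrt lam))"
      using U(2) Wm exp_ge_zero[of "- (real D * sqrt lam)"] by linarith
    finally show ?thesis unfolding A_def using U(1) W(1) by (simp add: prob_compl)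
  qed
  ultimately have "\<exists>A\<in>sets M. A \<subseteq> {\<omega>\<in>space M. distortion G n (max_filter_bank G n (gauss_vecs \<omega>)) \<le> ereal R}
      \<and> measure M A \<ge> 1 - 3 * exp (- real D * sqrt lam)"
    by (intro bexI[of _ A]) (auto simp: A_def)
  then show ?thesis
    unfolding Let_def R_def B_def p_def M_def lam_def L_def X_def m_def D_def .
qed

end
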